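(* Let $p$ be a prime, $s\in\mathbb{C}$ with $0<|s|<1$, $a\in\mathbb{C}\setminus\{0\}$, and suppose that $\Omega^{(\infty)}_{s,a}:(T_p,\rho_\alpha)\to\mathbb{R}^3$ with $\alpha=1/D_s$ is an L-isometry. Then there is a (globally defined) Lipschitz vector field $\Gamma:\mathbb{R}^3\to\mathbb{R}^3$ such that for all $f\in T_p$ $$\Gamma\big(\Omega^{(\infty)}_{s,a}(f)\big)=-2\pi\Big(L_{(2)}\Omega^{(\infty)}_{s,a}(f)+p^{-1}\operatorname{Re}\Big(\tilde\chi^{(\infty)}_{-1}(f)\,(L_{(3)}+iL_{(1)})\Big)\,\Omega^{(\infty)}_{s/p,+0a}(f)\Big).$$ The action of the one-parameter group of homeomorphisms $U_t:\mathbb{R}^3\to\mathbb{R}^3$ ($t\in\mathbb{R}$) generated by the equation $\frac{d}{dt}\mathbf{r}=\Gamma(\mathbf{r})$ is compatible with the action of $\mathbb{R}$ on $T_p$ in the sense that $$\Omega^{(\infty)}_{s,a}(f_t)=U_t\,\Omega^{(\infty)}_{s,a}(f)\qquad\text{for all } f\in T_p,\ t\in\mathbb{R}.$$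
   Context: For $x\in\mathbb{Z}_p$, $x=\sum_{n\ge0}x_np^n$ with $x_n\in\{0,\dots,p-1\}$; set $x_n=0$ for $n<0$; $|x|_p=p^{-v(x)}$ is the $p$-adic absolute value ($v$ the $p$-adic valuation); $D_s=-1/\log_p|s|$. The $p$-adic solenoid is $T_p=(\mathbb{R}\times\mathbb{Z}_p)/B$, $B=\{(n,-n):n\in\mathbb{Z}\}$, with canonical projection $\phi$ and the metric $\rho_\alpha(f,g)=\inf\{\max(|\xi-\eta|,|x-y|_p^\alpha):(\xi,x)\in f,\ (\eta,y)\in g\}$. The group $\mathbb{R}$ acts on $T_p$ by $f\mapsto f_t=f+\phi(t,0)$. For integers $n\ge-1$ let $\tilde\chi_n^{(\infty)}(\xi,x)=\exp(2\pi i\xi/p^{n+1})\exp\big(\frac{2\pi i}{p}\sum_{k=0}^\infty x_{n-k}p^{-k}\big)$ on $\mathbb{R}\times\mathbb{Z}_p$; this is constant on cosets of $B$, hence defines a function on $T_p$ (in particular $\tilde\chi^{(\infty)}_{-1}(\phi(\xi,x))=e^{2\pi i\xi}$). For $|s|<1$ let $\omega^{(\infty)}_s(\xi,x)=\sum_{n=0}^\infty s^n\tilde\chi^{(\infty)}_n(\xi,x)$. For $a\in\mathbb{C}\setminus\{0\}$, $\Omega^{(\infty)}_{s,a}:T_p\to\mathbb{R}^3$ sends $\phi(\xi,x)$ to the column vector $(x_1,x_2,x_3)$ given, with $z=\omega^{(\infty)}_s(\xi,x)$, by $x_1+ix_3=e^{2\pi i\xi}|a|(1+\operatorname{Re}(z/a))$,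 $x_2=|a|\operatorname{Im}(z/a)$. Put $\Omega^{(\infty)}_{s/p,+0a}(f)=\lim_{\varepsilon\to+0}\Omega^{(\infty)}_{s/p,\varepsilon a}(f)$. $L_{(k)}$ ($k=1,2,3$) is the $3\times3$ matrix with entries $(L_{(k)})_{i,j}=\varepsilon_{i,j,k}$, the Levi-Civita symbol; the real part of a complex matrix is taken entrywise. A map $\Phi:(M,\rho)\to(N,\rho')$ is an L-isometry if there is $C\ge1$ with $C^{-1}\rho(u,w)\le\rho'(\Phi(u),\Phi(w))\le C\rho(u,w)$ for all $u,w\in M$. $\mathbb{R}^3$ carries the Euclidean metric.
   Formalization: In the formula for Γ the term L_(2)Ω(f) is taken with a minus sign: with the stated conventions e^{2πiξ} rotates with generator +2πL_(2), so the printed plus sign is incompatible with Ω(f_t)=U_tΩ(f) (e.g. p=2, s=1/10, a=2). *)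

theory Defs
  imports "HOL-Analysis.Analysis" "HOL-Algebra.Coset"
begin

section \<open>The \<open>p\<close>-adic integers\<close>

text \<open>
  \<open>\<int>\<^sub>p\<close> is the inverse limit of the groups \<open>\<int>/p\<^sup>n\<close>: an element is the sequence \<open>x\<close> whose term
  \<open>x n\<close> is the representative modulo \<open>p\<^sup>n\<close> in \<open>{0..<p\<^sup>n}\<close>.  Only the additive group is needed.
\<close>

definition padic_int_group :: "nat \<Rightarrow> (nat \<Rightarrow> int) monoid" where
  "padic_int_group p =
    \<lparr>carrier = {x. \<forall>n. 0 \<le> x n \<and> x n < int p ^ n \<and> x (Suc n) mod int p ^ n = x n},
     monoid.mult = (\<lambda>x y n. (x n + y n) mod int p ^ n),
     one = (\<lambda>n. 0)\<rparr>"

definition padic_of_int :: "nat \<Rightarrow> int \<Rightarrow> nat \<Rightarrow> int" where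
  "padic_of_int p m = (\<lambda>n. m mod int p ^ n)"

text \<open>
  The digits of \<open>x = (\<Sum>n. x\<^sub>n p\<^sup>n)\<close>: as \<open>x (n + 1) = x\<^sub>0 + x\<^sub>1 p + \<dots> + x\<^sub>n p\<^sup>n\<close>, the top digit is a
  quotient.
\<close>

definition padic_digit :: "nat \<Rightarrow> (nat \<Rightarrow> int) \<Rightarrow> int \<Rightarrow> int" where
  "padic_digit p x n = (if n < 0 then 0 else x (Suc (nat n)) div int p ^ nat n)"

text \<open>\<open>x n = 0\<close> says that \<open>p\<^sup>n\<close> divides \<open>x\<close>.\<close>

definition padic_val :: "(nat \<Rightarrow> int) \<Rightarrow> nat" where
  "padic_val x = (GREATEST n. x n = 0)"

definition padic_abs :: "nat \<Rightarrow> (nat \<Rightarrow> int) \<Rightarrow> real" where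
  "padic_abs p x = (if x = (\<lambda>n. 0) then 0 else real p powr (- real (padic_val x)))"

definition padic_dist :: "nat \<Rightarrow> (nat \<Rightarrow> int) \<Rightarrow> (nat \<Rightarrow> int) \<Rightarrow> real" where
  "padic_dist p x y =
    padic_abs p (x \<otimes>\<^bsub>padic_int_group p\<^esub> inv\<^bsub>padic_int_group p\<^esub> y)"


section \<open>The \<open>p\<close>-adic solenoid\<close>

definition real_add_group :: "real monoid" where
  "real_add_group = \<lparr>carrier = UNIV, monoid.mult = (+), one = 0\<rparr>"

definition solenoid_cover :: "nat \<Rightarrow> (real \<times> (nat \<Rightarrow> int)) monoid" where
  "solenoid_cover p = real_add_group \<times>\<times> padic_int_group p"

definition solenoid_lattice :: "nat \<Rightarrow> (real \<times> (nat \<Rightarrow> int)) set" where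
  "solenoid_lattice p = range (\<lambda>n::int. (real_of_int n, padic_of_int p (- n)))"

definition solenoid :: "nat \<Rightarrow> (real \<times> (nat \<Rightarrow> int)) set monoid" where
  "solenoid p = solenoid_cover p Mod solenoid_lattice p"

definition solenoid_proj :: "nat \<Rightarrow> real \<times> (nat \<Rightarrow> int) \<Rightarrow> (real \<times> (nat \<Rightarrow> int)) set" where
  "solenoid_proj p u = solenoid_lattice p #>\<^bsub>solenoid_cover p\<^esub> u"

definition solenoid_dist ::
    "nat \<Rightarrow> real \<Rightarrow> (real \<times> (nat \<Rightarrow> int)) set \<Rightarrow> (real \<times> (nat \<Rightarrow> int)) set \<Rightarrow> real" where
  "solenoid_dist p \<alpha> f g =
    Inf {max \<bar>\<xi> - \<eta>\<bar> (padic_dist p x y powr \<alpha>) | \<xi> x \<eta> y. (\<xi>, x) \<in> f \<and> (\<eta>, y) \<in> g}"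

definition solenoid_shift ::
    "nat \<Rightarrow> real \<Rightarrow> (real \<times> (nat \<Rightarrow> int)) set \<Rightarrow> (real \<times> (nat \<Rightarrow> int)) set" where
  "solenoid_shift p t f =
    f \<otimes>\<^bsub>solenoid p\<^esub> solenoid_proj p (t, \<one>\<^bsub>padic_int_group p\<^esub>)"


section \<open>Characters and the maps into three-dimensional space\<close>

definition chi_cover :: "nat \<Rightarrow> int \<Rightarrow> real \<times> (nat \<Rightarrow> int) \<Rightarrow> complex" where
  "chi_cover p n = (\<lambda>(\<xi>, x).
    exp (2 * of_real pi * \<i> * of_real \<xi> / of_nat p powi (n + 1)) *
    exp (2 * of_real pi * \<i> / of_nat p *
         (\<Sum>k. of_int (padic_digit p x (n - int k)) / of_nat p ^ k)))"

text \<open>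
  Functions constant on the cosets descend to the solenoid via \<^const>\<open>the_elem\<close>.
\<close>

definition chi :: "nat \<Rightarrow> int \<Rightarrow> (real \<times> (nat \<Rightarrow> int)) set \<Rightarrow> complex" where
  "chi p n f = the_elem (chi_cover p n ` f)"

definition omega_cover :: "nat \<Rightarrow> complex \<Rightarrow> real \<times> (nat \<Rightarrow> int) \<Rightarrow> complex" where
  "omega_cover p s u = (\<Sum>n. s ^ n * chi_cover p (int n) u)"

definition Omega_cover ::
    "nat \<Rightarrow> complex \<Rightarrow> complex \<Rightarrow> real \<times> (nat \<Rightarrow> int) \<Rightarrow> real ^ 3" where
  "Omega_cover p s a = (\<lambda>(\<xi>, x).
    let z = omega_cover p s (\<xi>, x);
        w = exp (2 * of_real pi * \<i> * of_real \<xi>) * of_real (cmod a * (1 + Re (z / a)))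
    in vector [Re w, cmod a * Im (z / a), Im w])"

definition Omega ::
    "nat \<Rightarrow> complex \<Rightarrow> complex \<Rightarrow> (real \<times> (nat \<Rightarrow> int)) set \<Rightarrow> real ^ 3" where
  "Omega p s a f = the_elem (Omega_cover p s a ` f)"

definition Omega_plus0 ::
    "nat \<Rightarrow> complex \<Rightarrow> complex \<Rightarrow> (real \<times> (nat \<Rightarrow> int)) set \<Rightarrow> real ^ 3" where
  "Omega_plus0 p s a f = Lim (at_right 0) (\<lambda>\<epsilon>::real. Omega p s (of_real \<epsilon> * a) f)"


section \<open>Rotation generators\<close>

definition levi_civita :: "3 \<Rightarrow> 3 \<Rightarrow> 3 \<Rightarrow> int" where
  "levi_civita i j k =
    (if (i, j, k) \<in> {(1, 2, 3), (2, 3, 1), (3, 1, 2)} then 1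
     else if (i, j, k) \<in> {(1, 3, 2), (3, 2, 1), (2, 1, 3)} then - 1
     else 0)"

text \<open>
  Orientation: \<open>rot_gen k *v r\<close> is the cross product of \<open>r\<close> with the \<open>k\<close>-th unit vector (in this
  order).  In particular \<open>rot_gen 2 *v (r\<^sub>1, r\<^sub>2, r\<^sub>3) = (- r\<^sub>3, 0, r\<^sub>1)\<close>, so the rotation
  \<open>r\<^sub>1 + \<i> r\<^sub>3 \<mapsto> exp (2 \<pi> \<i> t) (r\<^sub>1 + \<i> r\<^sub>3)\<close>, by which the flow acts on the first factor of
  \<^const>\<open>Omega_cover\<close>, has the generator \<open>+ 2 \<pi> rot_gen 2\<close>, not \<open>- 2 \<pi> rot_gen 2\<close>.
\<close>

definition rot_gen :: "3 \<Rightarrow> 'a::comm_ring_1 ^ 3 ^ 3" where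
  "rot_gen k = (\<chi> i j. of_int (levi_civita i j k))"


section \<open>L-isometries and generated one-parameter groups\<close>

definition L_isometry_on ::
    "'a set \<Rightarrow> ('a \<Rightarrow> 'a \<Rightarrow> real) \<Rightarrow> ('b \<Rightarrow> 'b \<Rightarrow> real) \<Rightarrow> ('a \<Rightarrow> 'b) \<Rightarrow> bool" where
  "L_isometry_on M d d' \<Phi> \<longleftrightarrow>
    (\<exists>C\<ge>1. \<forall>u\<in>M. \<forall>w\<in>M.
      inverse C * d u w \<le> d' (\<Phi> u) (\<Phi> w) \<and> d' (\<Phi> u) (\<Phi> w) \<le> C * d u w)"

definition fractal_dim :: "nat \<Rightarrow> complex \<Rightarrow> real" where
  "fractal_dim p s = - 1 / log (real p) (cmod s)"

definition homeo_group_generated_by ::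
    "(real ^ 3 \<Rightarrow> real ^ 3) \<Rightarrow> (real \<Rightarrow> real ^ 3 \<Rightarrow> real ^ 3) \<Rightarrow> bool" where
  "homeo_group_generated_by \<Gamma> U \<longleftrightarrow>
    (\<forall>t. \<exists>V. homeomorphism UNIV UNIV (U t) V) \<and>
    U 0 = id \<and> (\<forall>t t'. U (t + t') = U t \<circ> U t') \<and>
    (\<forall>r t. ((\<lambda>\<tau>. U \<tau> r) has_vector_derivative \<Gamma> (U t r)) (at t))"

end

theory Submission
  imports Defs
begin

text \<open>
  Along the flow of the solenoid, the curve \<open>t \<mapsto> \<Omega>(f\<^sub>t)\<close> moves only the real coordinate of a
  representative.  As \<open>\<chi>\<^sub>n(\<xi>, x) = exp (2 \<pi> \<i> (\<xi> + x) / p\<^sup>n\<^sup>+\<^sup>1)\<close>, termwise differentiation gives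
  \<open>\<partial>\<omega>\<^sub>s/\<partial>\<xi> = (2 \<pi> \<i> / p) \<omega>\<close>, with the parameter \<open>s / p\<close> in the \<open>\<omega>\<close> on the right.  Hence the velocity
  of the curve is a rotation about the second axis plus a term that is linear in this \<open>\<omega>\<close>, and
  this is the prescribed field, the limit \<open>\<epsilon> \<rightarrow> +0\<close> being a way to write the linear term
  (\<open>solenoid_field_eq\<close>, \<open>Omega_cover_derivative\<close>).

  The metric of the solenoid has the exponent for which \<open>\<bar>p\<^sup>n\<bar>\<^sub>p\<close> becomes \<open>\<bar>s\<bar>\<^sup>n\<close>, the rate at which the
  terms of \<open>\<omega>\<^sub>s\<close> decay.  The extra factors \<open>p\<^sup>-\<^sup>n\<close> in the differentiated series therefore make it
  Lipschitz term by term (\<open>omega_cover_lipschitz\<close>), and the velocity is a Lipschitz function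
  on the solenoid (\<open>drift_lipschitz\<close>).  Since \<open>\<Omega>\<close> is an L-isometry, the velocity is also a Lipschitz
  function of the image point in the Euclidean metric, and McShane's formula, used in each
  coordinate, extends it to the whole space (\<open>factors_through_lipschitz_map\<close>).

  A Lipschitz field on a Euclidean space has exactly one global flow
  (\<open>lipschitz_field_generates_flow\<close>): solutions come from a contraction in a space of functions with
  bounded weighted norm, uniqueness and continuity from Gronwall's estimate.  The curve
  \<open>t \<mapsto> \<Omega>(f\<^sub>t)\<close> solves the equation with the initial value \<open>\<Omega>(f)\<close>, so it is the orbit of \<open>\<Omega>(f)\<close>
  under the flow.
\<close>

section \<open>Extending Lipschitz maps\<close>

text \<open>
  McShane's extension: \<open>G\<close> is the largest function below all the cones
  \<open>x \<mapsto> g y + L * dist x y\<close> with apex on the graph of \<open>g\<close>.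
\<close>

lemma real_lipschitz_extension:
  fixes g :: "'a::metric_space \<Rightarrow> real"
  assumes "L-lipschitz_on S g"
  obtains G where "L-lipschitz_on UNIV G" "\<And>x. x \<in> S \<Longrightarrow> G x = g x"
proof (cases "S = {}")
  case True
  have "L-lipschitz_on UNIV (\<lambda>_::'a. 0::real)"
    by (intro lipschitz_onI) (use lipschitz_on_nonneg[OF assms] in auto)
  with True that show ?thesis by blast
next
  case False
  note L0 = lipschitz_on_nonneg[OF assms]
  have low: "g z - L * dist z x \<le> g y + L * dist x y" if "y \<in> S" "z \<in> S" for x y z
  proof -
    have "g z - g y \<le> L * dist z y"
      using lipschitz_onD[OF assms that(2) that(1)] by (simp add: dist_real_def)
    also have "\<dots> \<le> L * (dist z x + dist x y)"
      by (intro mult_left_mono dist_triangle L0)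
    finally show ?thesis by (simp add: algebra_simps)
  qed
  define G where "G = (\<lambda>x. INF y\<in>S. g y + L * dist x y)"
  obtain z where z: "z \<in> S" using False by blast
  have bdd: "bdd_below ((\<lambda>y. g y + L * dist x y) ` S)" for x
    using low[OF _ z] by (intro bdd_belowI2) blast
  have le: "G x \<le> G x' + L * dist x x'" for x x'
  proof -
    have "G x - L * dist x x' \<le> g y + L * dist x' y" if "y \<in> S" for y
    proof -
      have "G x \<le> g y + L * dist x y"
        unfolding G_def by (rule cINF_lower[OF bdd that])
      also have "\<dots> \<le> g y + L * (dist x x' + dist x' y)"
        by (intro add_left_mono mult_left_mono dist_triangle L0)
      finally show ?thesis by (simp add: algebra_simps)
    qed
    then have "G x - L * dist x x' \<le> G x'"
      unfolding G_def[of] by (intro cINF_greatest False) (auto simp: G_def)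
    then show ?thesis by simp
  qed
  have "L-lipschitz_on UNIV G"
  proof (rule lipschitz_onI)
    show "dist (G x) (G y) \<le> L * dist x y" for x y
      using le[of x y] le[of y x] by (auto simp: dist_real_def dist_commute abs_le_iff)
  qed (rule L0)
  moreover have "G x = g x" if "x \<in> S" for x
  proof (rule antisym)
    show "G x \<le> g x"
      using cINF_lower[OF bdd[of x] that] by (simp add: G_def)
    show "g x \<le> G x"
      unfolding G_def using low[OF _ that, of _ x] by (intro cINF_greatest False) auto
  qed
  ultimately show ?thesis by (rule that)
qed

text \<open>
  Extending coordinate by coordinate increases the Lipschitz constant, by a factor of at most the
  dimension; only its finiteness matters here.
\<close>

lemma euclidean_lipschitz_extension:
  fixes g :: "'a::metric_space \<Rightarrow> 'b::euclidean_space"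
  assumes "L-lipschitz_on S g"
  obtains M G where "M-lipschitz_on UNIV G" "\<And>x. x \<in> S \<Longrightarrow> G x = g x"
proof -
  have "\<exists>G. L-lipschitz_on UNIV G \<and> (\<forall>x\<in>S. G x = g x \<bullet> b)" if "b \<in> Basis" for b
  proof -
    have "L-lipschitz_on S (\<lambda>x. g x \<bullet> b)"
    proof (rule lipschitz_onI)
      fix x y assume "x \<in> S" "y \<in> S"
      have "dist (g x \<bullet> b) (g y \<bullet> b) = \<bar>(g x - g y) \<bullet> b\<bar>"
        by (simp add: dist_real_def inner_diff_left)
      also have "\<dots> \<le> norm (g x - g y)" by (rule Basis_le_norm[OF that])
      also have "\<dots> \<le> L * dist x y"
        using lipschitz_onD[OF assms \<open>x \<in> S\<close> \<open>y \<in> S\<close>] by (simp add: dist_norm)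
      finally show "dist (g x \<bullet> b) (g y \<bullet> b) \<le> L * dist x y" .
    qed (rule lipschitz_on_nonneg[OF assms])
    from real_lipschitz_extension[OF this] obtain G where
      "L-lipschitz_on UNIV G" "\<And>x. x \<in> S \<Longrightarrow> G x = g x \<bullet> b"
      by blast
    then show ?thesis by blast
  qed
  then obtain G where G: "\<And>b. b \<in> Basis \<Longrightarrow> L-lipschitz_on UNIV (G b)"
      "\<And>b x. b \<in> Basis \<Longrightarrow> x \<in> S \<Longrightarrow> G b x = g x \<bullet> b" by metis
  define H where "H = (\<lambda>x. \<Sum>b\<in>Basis. G b x *\<^sub>R b)"
  have "(real DIM('b) * L)-lipschitz_on UNIV H"
  proof (rule lipschitz_onI)
    fix x y :: 'a
    have "norm (H x - H y) = norm (\<Sum>b\<in>Basis. (G b x - G b y) *\<^sub>R b)"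
      by (simp add: H_def sum_subtractf scaleR_left_diff_distrib)
    also have "\<dots> \<le> (\<Sum>b\<in>(Basis::'b set). L * dist x y)"
    proof (rule sum_norm_le)
      fix b :: 'b assume "b \<in> Basis"
      then show "norm ((G b x - G b y) *\<^sub>R b) \<le> L * dist x y"
        using lipschitz_onD[OF G(1), of b x y] by (simp add: dist_real_def)
    qed
    finally show "dist (H x) (H y) \<le> real DIM('b) * L * dist x y"
      by (simp add: dist_norm mult.assoc)
  qed (use lipschitz_on_nonneg[OF assms] in simp)
  moreover have "H x = g x" if "x \<in> S" for x
  proof -
    have "H x = (\<Sum>b\<in>Basis. (g x \<bullet> b) *\<^sub>R b)"
      unfolding H_def by (intro sum.cong refl) (simp add: G(2) that)
    then show ?thesis by (simp add: euclidean_representation)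
  qed
  ultimately show ?thesis by (rule that)
qed

section \<open>The flow of a Lipschitz vector field\<close>

text \<open>
  The absolute value on the right lets one bound serve positive and negative times: for \<open>t < 0\<close>
  the function \<open>\<phi>\<close> is negative.
\<close>

lemma norm_le_of_derivative_bound:
  fixes F :: "real \<Rightarrow> 'a::euclidean_space"
  assumes F: "\<And>t. (F has_vector_derivative f t) (at t)" "F 0 = 0"
    and \<phi>: "\<And>t. (\<phi> has_real_derivative \<phi>' t) (at t)" "\<phi> 0 = 0"
    and le: "\<And>t. norm (f t) \<le> \<phi>' t"
  shows "norm (F t) \<le> \<bar>\<phi> t\<bar>"
proof -
  have *: "norm (F y - F x) \<le> \<phi> y - \<phi> x" if "x < y" for x y
  proof (rule differentiable_bound_general[OF that])
    show "continuous_on {x..y} F"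
      using F(1) by (auto intro!: continuous_at_imp_continuous_on has_vector_derivative_continuous)
    show "continuous_on {x..y} \<phi>"
      using \<phi>(1) by (auto intro!: continuous_at_imp_continuous_on DERIV_isCont)
  qed (use F \<phi> le in \<open>auto simp: has_real_derivative_iff_has_vector_derivative\<close>)
  consider "t < 0" | "t = 0" | "t > 0" by linarith
  then show ?thesis
    using *[of t 0] *[of 0 t] F(2) \<phi>(2) by cases auto
qed

text \<open>
  Gronwall's estimate without an integral inequality: the squared distance \<open>h\<close> of two solutions
  satisfies \<open>\<bar>h'\<bar> \<le> 2 L h\<close>, so \<open>h t * exp (- 2 L t)\<close> decreases and \<open>h t * exp (2 L t)\<close> increases.
  It gives uniqueness of solutions and their continuous dependence on the initial value.
\<close>

lemma lipschitz_ode_gronwall: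
  fixes \<Gamma> :: "'a::euclidean_space \<Rightarrow> 'a"
  assumes L: "L-lipschitz_on UNIV \<Gamma>"
    and x: "\<And>t. (x has_vector_derivative \<Gamma> (x t)) (at t)"
    and y: "\<And>t. (y has_vector_derivative \<Gamma> (y t)) (at t)"
  shows "norm (x t - y t) \<le> exp (L * \<bar>t\<bar>) * norm (x 0 - y 0)"
proof -
  define h where "h = (\<lambda>t. (x t - y t) \<bullet> (x t - y t))"
  define h' where "h' = (\<lambda>t. 2 * ((x t - y t) \<bullet> (\<Gamma> (x t) - \<Gamma> (y t))))"
  have h: "(h has_real_derivative h' t) (at t)" for t
  proof -
    have "((\<lambda>t. x t - y t) has_derivative (\<lambda>d. d *\<^sub>R (\<Gamma> (x t) - \<Gamma> (y t)))) (at t)"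
      using has_vector_derivative_diff[OF x y] by (simp add: has_vector_derivative_def)
    from has_derivative_inner[OF this this]
    show ?thesis
      unfolding h_def h'_def has_field_derivative_def
      by (rule has_derivative_eq_rhs) (auto simp: inner_commute algebra_simps)
  qed
  have h'_le: "\<bar>h' t\<bar> \<le> 2 * L * h t" for t
  proof -
    have "\<bar>(x t - y t) \<bullet> (\<Gamma> (x t) - \<Gamma> (y t))\<bar> \<le> norm (x t - y t) * norm (\<Gamma> (x t) - \<Gamma> (y t))"
      by (rule Cauchy_Schwarz_ineq2)
    also have "\<dots> \<le> norm (x t - y t) * (L * norm (x t - y t))"
      using lipschitz_onD[OF L, of "x t" "y t"] by (intro mult_left_mono) (auto simp: dist_norm)
    finally show ?thesis
      by (simp add: h'_def h_def abs_mult dot_square_norm power2_eq_square mult.left_commute)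
  qed
  have "h t \<le> exp (2 * L * \<bar>t\<bar>) * h 0"
  proof (cases "t \<ge> 0")
    case True
    have "h t * exp (- 2 * L * t) \<le> h 0 * exp (- 2 * L * 0)"
    proof (rule DERIV_nonpos_imp_nonincreasing[OF True])
      fix s
      have "((\<lambda>t. h t * exp (- 2 * L * t)) has_real_derivative
          (h' s - 2 * L * h s) * exp (- 2 * L * s)) (at s)"
        by (auto intro!: derivative_eq_intros h simp: algebra_simps)
      moreover have "(h' s - 2 * L * h s) * exp (- 2 * L * s) \<le> 0"
        using h'_le[of s] by (intro mult_nonpos_nonneg) auto
      ultimately show "\<exists>d. ((\<lambda>t. h t * exp (- 2 * L * t)) has_real_derivative d) (at s) \<and> d \<le> 0"
        by blast
    qed
    with True show ?thesis by (simp add: exp_minus field_simps)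
  next
    case False
    then have "t \<le> 0" by simp
    have "h t * exp (2 * L * t) \<le> h 0 * exp (2 * L * 0)"
    proof (rule DERIV_nonneg_imp_nondecreasing[OF \<open>t \<le> 0\<close>])
      fix s
      have "((\<lambda>t. h t * exp (2 * L * t)) has_real_derivative
          (h' s + 2 * L * h s) * exp (2 * L * s)) (at s)"
        by (auto intro!: derivative_eq_intros h simp: algebra_simps)
      moreover have "(h' s + 2 * L * h s) * exp (2 * L * s) \<ge> 0"
        using h'_le[of s] by (intro mult_nonneg_nonneg) auto
      ultimately show "\<exists>d. ((\<lambda>t. h t * exp (2 * L * t)) has_real_derivative d) (at s) \<and> 0 \<le> d"
        by blast
    qed
    with False show ?thesis by (simp add: exp_minus field_simps)
  qed
  also have "exp (2 * L * \<bar>t\<bar>) = (exp (L * \<bar>t\<bar>))\<^sup>2"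
    by (simp add: power2_eq_square flip: exp_add)
  finally have "(norm (x t - y t))\<^sup>2 \<le> (exp (L * \<bar>t\<bar>) * norm (x 0 - y 0))\<^sup>2"
    by (simp add: h_def dot_square_norm power_mult_distrib)
  then show ?thesis by (rule power2_le_imp_le) simp
qed

text \<open>
  The weight \<open>K t = cosh (c t)\<close> of the next lemma has an antiderivative that vanishes at 0 and is
  bounded by \<open>K / c\<close> on the whole line.  So integration from 0 has norm at most \<open>1 / c\<close> on the
  functions that are bounded by a multiple of \<open>K\<close>.
\<close>

lemma cosh_antiderivative:
  fixes c :: real
  assumes "c > 0"
  shows "((\<lambda>t. sinh (c * t) / c) has_real_derivative cosh (c * t)) (at t)"
    and "\<bar>sinh (c * t) / c\<bar> \<le> cosh (c * t) / c"
proof -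
  show "((\<lambda>t. sinh (c * t) / c) has_real_derivative cosh (c * t)) (at t)"
    using assms by (auto intro!: derivative_eq_intros)
  have "\<bar>sinh (c * t)\<bar> \<le> cosh (c * t)"
    using sinh_le_cosh_real[of "c * t"] sinh_le_cosh_real[of "- (c * t)"] by (simp add: abs_le_iff)
  then show "\<bar>sinh (c * t) / c\<bar> \<le> cosh (c * t) / c"
    using assms by (simp add: divide_right_mono)
qed

text \<open>
  Picard iteration on all of \<open>\<real>\<close> at once.  Solutions grow at most exponentially, so they are sought as
  \<open>r + K t * y t\<close> with \<open>y\<close> bounded and continuous and the weight \<open>K t = cosh (c t)\<close>.  On such \<open>y\<close> the
  integral operator is Lipschitz with constant \<open>L / c\<close>, hence a contraction for large \<open>c\<close>, and no
  continuation of local solutions is needed.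
\<close>

lemma lipschitz_ode_solution_exists:
  fixes \<Gamma> :: "'a::euclidean_space \<Rightarrow> 'a"
  assumes lip: "L-lipschitz_on UNIV \<Gamma>"
  obtains x where "x 0 = r" "\<And>t. (x has_vector_derivative \<Gamma> (x t)) (at t)"
proof -
  note L0 = lipschitz_on_nonneg[OF lip]
  \<comment> \<open>Twice \<open>L\<close> makes the contraction factor \<open>1/2\<close>; the summand 1 keeps \<open>c\<close> positive when \<open>L = 0\<close>.\<close>
  define c where "c = 2 * L + 1"
  have c: "c > 0" "L / c \<le> 1/2" using L0 by (auto simp: c_def field_simps)
  define K where "K = (\<lambda>t. cosh (c * t))"
  have K: "K t \<ge> 1" "K t > 0" for t by (auto simp: K_def cosh_real_ge_1)
  have K0: "K t \<noteq> 0" for t using K(2)[of t] by simp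
  have contK: "continuous_on UNIV K"
    unfolding K_def by (intro continuous_intros)
  define M where "M = norm (\<Gamma> r)"
  \<comment> \<open>The velocity along the curve encoded by \<open>y\<close>; \<open>F y\<close> below is its integral from 0.\<close>
  define v where "v = (\<lambda>(y :: real \<Rightarrow>\<^sub>C 'a) t. \<Gamma> (r + K t *\<^sub>R apply_bcontfun y t))"
  have contv: "continuous_on UNIV (v y)" for y
  proof -
    have "continuous_on UNIV (\<lambda>t. r + K t *\<^sub>R apply_bcontfun y t)"
      by (intro continuous_intros contK) auto
    from continuous_on_compose2[OF lipschitz_on_continuous_on[OF lip] this]
    show ?thesis by (simp add: v_def)
  qed
  have "\<exists>F. F 0 = 0 \<and> (\<forall>t. (F has_vector_derivative v y t) (at t))" for y
  proof -
    have "\<exists>F. \<forall>t::real. -\<infinity> < ereal t \<longrightarrow> ereal t < \<infinity> \<longrightarrow> (F has_vector_derivative v y t) (at t)"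
      using contv[of y]
      by (intro einterval_antiderivative) (auto simp: continuous_on_eq_continuous_at)
    then obtain F where "\<And>t. (F has_vector_derivative v y t) (at t)" by auto
    then have "\<And>t. ((\<lambda>t. F t - F 0) has_vector_derivative v y t) (at t)"
      by (auto intro!: derivative_eq_intros)
    then show ?thesis by (intro exI[of _ "\<lambda>t. F t - F 0"]) auto
  qed
  then obtain F where F: "\<And>y. F y 0 = 0" "\<And>y t. (F y has_vector_derivative v y t) (at t)"
    by metis
  have bound: "norm (G t) \<le> B * K t / c"
    if "\<And>t. (G has_vector_derivative g t) (at t)" "G 0 = 0" "\<And>t. norm (g t) \<le> B * K t"
    for G :: "real \<Rightarrow> 'a" and g B t
  proof -
    have "0 \<le> B * K 0" using that(3)[of 0] norm_ge_zero order_trans by blast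
    then have B: "B \<ge> 0" by (simp add: K_def)
    have "norm (G t) \<le> \<bar>B * (sinh (c * t) / c)\<bar>"
    proof (rule norm_le_of_derivative_bound[OF that(1,2) _ _ that(3)])
      show "((\<lambda>t. B * (sinh (c * t) / c)) has_real_derivative B * K t) (at t)" for t
        unfolding K_def by (rule DERIV_cmult[OF cosh_antiderivative(1)[OF c(1)]])
    qed auto
    also have "\<dots> \<le> B * (cosh (c * t) / c)"
      unfolding abs_mult abs_of_nonneg[OF B] by (intro mult_left_mono cosh_antiderivative(2) c B)
    finally show ?thesis by (simp add: K_def)
  qed
  have lipv: "norm (\<Gamma> u - \<Gamma> w) \<le> L * norm (u - w)" for u w
    using lipschitz_onD[OF lip, of u w] by (simp add: dist_norm)
  have "(\<lambda>t. F y t /\<^sub>R K t) \<in> bcontfun" for y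
  proof (rule bcontfun_normI)
    have "continuous_on UNIV (F y)"
      using F(2) by (auto intro!: continuous_at_imp_continuous_on has_vector_derivative_continuous)
    then show "continuous_on UNIV (\<lambda>t. F y t /\<^sub>R K t)"
      using K0 by (intro continuous_intros contK) auto
    have "norm (v y t) \<le> (M + L * norm y) * K t" for t
    proof -
      have "norm (v y t) \<le> M + norm (v y t - \<Gamma> r)"
        unfolding M_def by (metis add.commute norm_triangle_sub)
      also have "norm (v y t - \<Gamma> r) \<le> L * (K t * norm (apply_bcontfun y t))"
        using lipv[of "r + K t *\<^sub>R apply_bcontfun y t" r] K(2)[of t] by (simp add: v_def)
      also have "\<dots> \<le> L * (K t * norm y)"
        using K(2)[of t] by (intro mult_left_mono norm_bounded L0) auto
      also have "M \<le> M * K t" using K(1)[of t] by (simp add: M_def mult_le_cancel_left1)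
      finally show ?thesis by (simp add: algebra_simps)
    qed
    from bound[OF F(2) F(1) this]
    show "norm (F y t /\<^sub>R K t) \<le> (M + L * norm y) / c" for t
      using K(2)[of t] by (simp add: field_simps)
  qed
  then have TT: "apply_bcontfun (Bcontfun (\<lambda>t. F y t /\<^sub>R K t)) = (\<lambda>t. F y t /\<^sub>R K t)" for y
    by (simp add: Bcontfun_inverse)
  define T where "T = (\<lambda>y. Bcontfun (\<lambda>t. F y t /\<^sub>R K t))"
  have "\<exists>!y. T y = y"
  proof (rule banach_fix_type[where c = "1/2"])
    have "dist (T y) (T z) \<le> 1/2 * dist y z" for y z
    proof (rule dist_bound)
      fix t
      have d: "((\<lambda>t. F y t - F z t) has_vector_derivative (v y t - v z t)) (at t)" for t
        by (intro has_vector_derivative_diff F)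
      have "norm (v y t - v z t) \<le> (L * dist y z) * K t" for t
      proof -
        have "norm (v y t - v z t) \<le> L * norm (K t *\<^sub>R (apply_bcontfun y t - apply_bcontfun z t))"
          using lipv[of "r + K t *\<^sub>R apply_bcontfun y t" "r + K t *\<^sub>R apply_bcontfun z t"]
          by (simp add: v_def algebra_simps)
        also have "\<dots> = L * (K t * dist (apply_bcontfun y t) (apply_bcontfun z t))"
          using K(2)[of t] by (simp add: dist_norm)
        also have "\<dots> \<le> L * (K t * dist y z)"
          using K(2)[of t] by (intro mult_left_mono dist_bounded L0) auto
        finally show ?thesis by (simp add: algebra_simps)
      qed
      from bound[OF d _ this, of t]
      have "norm (F y t - F z t) \<le> L * dist y z * K t / c" by (simp add: F)
      then have "norm (F y t - F z t) / K t \<le> (L / c) * dist y z"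
        using K(2)[of t] by (simp add: field_simps)
      also have "\<dots> \<le> 1/2 * dist y z"
        by (intro mult_right_mono c) auto
      also have "norm (F y t - F z t) / K t = dist (apply_bcontfun (T y) t) (apply_bcontfun (T z) t)"
        using K(2)[of t] unfolding T_def TT dist_norm
        by (simp flip: scaleR_diff_right add: divide_inverse mult.commute)
      finally show "dist (apply_bcontfun (T y) t) (apply_bcontfun (T z) t) \<le> 1/2 * dist y z" .
    qed
    then show "\<forall>y z. dist (T y) (T z) \<le> 1/2 * dist y z" by blast
  qed auto
  then obtain y where "T y = y" by blast
  then have y: "apply_bcontfun y t = F y t /\<^sub>R K t" for t
    using TT[of y] by (simp add: T_def)
  have eq: "F y t = K t *\<^sub>R apply_bcontfun y t" for t
    using K0[of t] by (simp add: y)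
  show ?thesis
  proof (rule that[of "\<lambda>t. r + F y t"])
    show "((\<lambda>t. r + F y t) has_vector_derivative \<Gamma> (r + F y t)) (at t)" for t
      using has_vector_derivative_add[OF has_vector_derivative_const F(2)[of y t], of r]
      by (simp add: v_def eq)
  qed (simp add: F)
qed

lemma lipschitz_ode_solution_unique:
  fixes \<Gamma> :: "'a::euclidean_space \<Rightarrow> 'a"
  assumes "L-lipschitz_on UNIV \<Gamma>"
    and "\<And>t. (x has_vector_derivative \<Gamma> (x t)) (at t)"
    and "\<And>t. (y has_vector_derivative \<Gamma> (y t)) (at t)"
    and "x 0 = y 0"
  shows "x = y"
proof
  fix t
  show "x t = y t"
    using lipschitz_ode_gronwall[OF assms(1-3), of t] assms(4) by simp
qed

text \<open>
  The flow sends an initial value to the solution through it.  The group law is uniqueness of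
  solutions (a time shift of a solution is a solution), and continuity of each \<open>U t\<close> is Gronwall's
  estimate; the inverse of \<open>U t\<close> is \<open>U (- t)\<close>.
\<close>

lemma lipschitz_field_generates_flow:
  fixes \<Gamma> :: "real ^ 3 \<Rightarrow> real ^ 3"
  assumes lip: "L-lipschitz_on UNIV \<Gamma>"
  shows "\<exists>!U. homeo_group_generated_by \<Gamma> U"
proof -
  have "\<forall>r. \<exists>x. x 0 = r \<and> (\<forall>t. (x has_vector_derivative \<Gamma> (x t)) (at t))"
    by (metis lipschitz_ode_solution_exists[OF lip])
  then obtain X where X0: "\<And>r. X r 0 = r"
    and X: "\<And>r t. (X r has_vector_derivative \<Gamma> (X r t)) (at t)" by metis
  define U where "U = (\<lambda>t r. X r t)"
  have add: "U (t + t') = U t \<circ> U t'" for t t'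
  proof
    fix r
    have "((\<lambda>t. X r (t + t')) has_vector_derivative \<Gamma> (X r (t + t'))) (at t)" for t
      using vector_diff_chain_at[of "\<lambda>t. t + t'" 1 t "X r", OF _ X[of r "t + t'"]]
      by (simp add: o_def has_vector_derivative_add_const)
    from lipschitz_ode_solution_unique[OF lip this X, of "U t' r"]
    have "(\<lambda>t. X r (t + t')) = X (U t' r)" by (simp add: X0 U_def)
    then show "U (t + t') r = (U t \<circ> U t') r" by (auto simp: U_def dest: fun_cong)
  qed
  have cont: "continuous_on UNIV (U t)" for t
  proof (rule lipschitz_on_continuous_on)
    show "(exp (L * \<bar>t\<bar>))-lipschitz_on UNIV (U t)"
    proof (rule lipschitz_onI)
      show "dist (U t r) (U t r') \<le> exp (L * \<bar>t\<bar>) * dist r r'" for r r'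
        using lipschitz_ode_gronwall[OF lip X[of r] X[of r'], of t]
        by (simp add: dist_norm U_def X0)
    qed simp
  qed
  have U0: "U 0 = id" by (auto simp: U_def X0)
  have "homeo_group_generated_by \<Gamma> U"
    unfolding homeo_group_generated_by_def
  proof (intro conjI allI exI)
    fix t
    have "U (- t) (U t r) = r" "U t (U (- t) r) = r" for r
      using add[of "-t" t] add[of t "-t"] U0 by (auto simp: fun_eq_iff)
    then show "homeomorphism UNIV UNIV (U t) (U (- t))"
      by (intro homeomorphismI cont) auto
  qed (use U0 add X in \<open>auto simp: U_def\<close>)
  moreover have "U' = U" if "homeo_group_generated_by \<Gamma> U'" for U'
  proof (intro ext)
    fix t r
    have "(\<lambda>\<tau>. U' \<tau> r) = X r"
      using that by (intro lipschitz_ode_solution_unique[OF lip _ X])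
        (auto simp: homeo_group_generated_by_def X0)
    then show "U' t r = U t r" by (auto simp: U_def dest: fun_cong)
  qed
  ultimately show ?thesis by blast
qed

section \<open>The solenoid as a quotient group\<close>

lemma padic_carrier_mod:
  assumes "x \<in> carrier (padic_int_group p)" "m \<le> n"
  shows "x n mod int p ^ m = x m"
  using assms(2)
proof (induction n rule: dec_induct)
  case base
  show ?case using assms(1) by (simp add: padic_int_group_def)
next
  case (step n)
  have "x (Suc n) mod int p ^ m = x (Suc n) mod int p ^ n mod int p ^ m"
    using step(1) by (simp add: mod_mod_cancel le_imp_power_dvd)
  also have "x (Suc n) mod int p ^ n = x n"
    using assms(1) by (simp add: padic_int_group_def)
  finally show ?case using step by simp
qed

lemma padic_carrier_bounds:
  assumes "x \<in> carrier (padic_int_group p)"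
  shows "0 \<le> x n" "x n < int p ^ n"
  using assms by (auto simp: padic_int_group_def)

lemma padic_of_int_carrier: "p > 0 \<Longrightarrow> padic_of_int p m \<in> carrier (padic_int_group p)"
  by (auto simp: padic_int_group_def padic_of_int_def mod_mod_cancel)

lemma padic_mult: "(x \<otimes>\<^bsub>padic_int_group p\<^esub> y) n = (x n + y n) mod int p ^ n"
  by (simp add: padic_int_group_def)

lemma padic_one: "\<one>\<^bsub>padic_int_group p\<^esub> = (\<lambda>n. 0)"
  by (simp add: padic_int_group_def)

lemma padic_mult_closed:
  assumes "p > 0" "x \<in> carrier (padic_int_group p)" "y \<in> carrier (padic_int_group p)"
  shows "x \<otimes>\<^bsub>padic_int_group p\<^esub> y \<in> carrier (padic_int_group p)"
proof -
  have "(x (Suc n) + y (Suc n)) mod int p ^ Suc n mod int p ^ n = (x n + y n) mod int p ^ n" for n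
  proof -
    have "(x (Suc n) + y (Suc n)) mod int p ^ Suc n mod int p ^ n
        = (x (Suc n) mod int p ^ n + y (Suc n) mod int p ^ n) mod int p ^ n"
      by (simp add: mod_mod_cancel mod_add_eq)
    then show ?thesis using assms by (simp add: padic_carrier_mod del: power_Suc)
  qed
  then show ?thesis using assms(1) by (auto simp: padic_int_group_def)
qed

lemma padic_neg_closed:
  assumes "p > 0" "x \<in> carrier (padic_int_group p)"
  shows "(\<lambda>n. (- x n) mod int p ^ n) \<in> carrier (padic_int_group p)"
proof -
  have "(- x (Suc n)) mod int p ^ Suc n mod int p ^ n = (- x n) mod int p ^ n" for n
  proof -
    have "(- x (Suc n)) mod int p ^ Suc n mod int p ^ n = (- (x (Suc n) mod int p ^ n)) mod int p ^ n"
      by (simp add: mod_mod_cancel mod_minus_eq)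
    then show ?thesis using assms by (simp add: padic_carrier_mod del: power_Suc)
  qed
  then show ?thesis using assms(1) by (auto simp: padic_int_group_def)
qed

lemma comm_group_padic_int_group:
  assumes "p > 0"
  shows "comm_group (padic_int_group p)"
proof (rule comm_groupI)
  fix x y z
  show "x \<otimes>\<^bsub>padic_int_group p\<^esub> y \<otimes>\<^bsub>padic_int_group p\<^esub> z
      = x \<otimes>\<^bsub>padic_int_group p\<^esub> (y \<otimes>\<^bsub>padic_int_group p\<^esub> z)"
    by (simp add: padic_int_group_def mod_simps add.assoc)
  show "x \<otimes>\<^bsub>padic_int_group p\<^esub> y = y \<otimes>\<^bsub>padic_int_group p\<^esub> x"
    by (simp add: padic_int_group_def add.commute)
  assume x: "x \<in> carrier (padic_int_group p)"
  show "\<one>\<^bsub>padic_int_group p\<^esub> \<otimes>\<^bsub>padic_int_group p\<^esub> x = x"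
    using padic_carrier_mod[OF x order_refl] by (auto simp: padic_mult padic_one fun_eq_iff)
  show "\<exists>y\<in>carrier (padic_int_group p). y \<otimes>\<^bsub>padic_int_group p\<^esub> x = \<one>\<^bsub>padic_int_group p\<^esub>"
    using padic_neg_closed[OF assms x]
    by (intro bexI[of _ "\<lambda>n. (- x n) mod int p ^ n"])
      (auto simp: padic_mult padic_one fun_eq_iff mod_simps)
next
  show "\<one>\<^bsub>padic_int_group p\<^esub> \<in> carrier (padic_int_group p)"
    using assms by (simp add: padic_int_group_def)
qed (rule padic_mult_closed[OF assms])

lemma padic_inv:
  assumes "p > 0" "x \<in> carrier (padic_int_group p)"
  shows "inv\<^bsub>padic_int_group p\<^esub> x = (\<lambda>n. (- x n) mod int p ^ n)"
proof -
  interpret comm_group "padic_int_group p" by (rule comm_group_padic_int_group[OF assms(1)])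
  show ?thesis
    by (rule inv_equality)
      (use assms padic_neg_closed in \<open>auto simp: padic_mult padic_one fun_eq_iff mod_simps\<close>)
qed

lemma group_real_add: "group real_add_group"
  by (rule groupI) (auto simp: real_add_group_def intro: exI[of _ "- _"])

lemma cover_mult:
  "(\<xi>, x) \<otimes>\<^bsub>solenoid_cover p\<^esub> (\<eta>, y) = (\<xi> + \<eta>, x \<otimes>\<^bsub>padic_int_group p\<^esub> y)"
  by (simp add: solenoid_cover_def real_add_group_def)

lemma cover_carrier: "(\<xi>, x) \<in> carrier (solenoid_cover p) \<longleftrightarrow> x \<in> carrier (padic_int_group p)"
  by (simp add: solenoid_cover_def real_add_group_def)

lemma comm_group_solenoid_cover:
  assumes "p > 0"
  shows "comm_group (solenoid_cover p)"
proof -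
  interpret Z: comm_group "padic_int_group p" by (rule comm_group_padic_int_group[OF assms])
  interpret group "solenoid_cover p"
    unfolding solenoid_cover_def by (intro DirProd_group group_real_add Z.is_group)
  show ?thesis
    by (rule group_comm_groupI) (auto simp: cover_mult cover_carrier Z.m_comm)
qed

lemma normal_solenoid_lattice:
  assumes "p > 0"
  shows "solenoid_lattice p \<lhd> solenoid_cover p"
proof -
  interpret comm_group "solenoid_cover p" by (rule comm_group_solenoid_cover[OF assms])
  have mult: "(real_of_int m, padic_of_int p (- m)) \<otimes>\<^bsub>solenoid_cover p\<^esub>
      (real_of_int n, padic_of_int p (- n)) = (real_of_int (m + n), padic_of_int p (- (m + n)))" for m n
    by (auto simp: cover_mult padic_mult padic_of_int_def fun_eq_iff mod_simps)
  have one: "\<one>\<^bsub>solenoid_cover p\<^esub> = (real_of_int 0, padic_of_int p (- 0))"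
    by (simp add: solenoid_cover_def real_add_group_def padic_one padic_of_int_def)
  have carr: "(real_of_int n, padic_of_int p (- n)) \<in> carrier (solenoid_cover p)" for n
    by (simp add: cover_carrier padic_of_int_carrier assms)
  have inv: "inv\<^bsub>solenoid_cover p\<^esub> (real_of_int n, padic_of_int p (- n))
      = (real_of_int (- n), padic_of_int p (- (- n)))" for n
    by (rule inv_equality[OF _ carr carr]) (subst mult, simp add: one)
  have "subgroup (solenoid_lattice p) (solenoid_cover p)"
  proof (rule subgroupI)
    show "solenoid_lattice p \<subseteq> carrier (solenoid_cover p)" "solenoid_lattice p \<noteq> {}"
      using carr by (auto simp: solenoid_lattice_def)
    fix u v assume "u \<in> solenoid_lattice p" "v \<in> solenoid_lattice p"
    then obtain m n where uv: "u = (real_of_int m, padic_of_int p (- m))"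
        "v = (real_of_int n, padic_of_int p (- n))"
      by (auto simp: solenoid_lattice_def)
    show "inv\<^bsub>solenoid_cover p\<^esub> u \<in> solenoid_lattice p"
      unfolding uv inv solenoid_lattice_def by (rule rangeI)
    show "u \<otimes>\<^bsub>solenoid_cover p\<^esub> v \<in> solenoid_lattice p"
      unfolding uv mult solenoid_lattice_def by (rule rangeI)
  qed
  then show ?thesis by (simp add: normal_iff_subgroup)
qed

lemma solenoid_carrierE:
  assumes "f \<in> carrier (solenoid p)"
  obtains \<xi> x where "x \<in> carrier (padic_int_group p)" "f = solenoid_proj p (\<xi>, x)"
  using assms
  by (auto simp: solenoid_def FactGroup_def RCOSETS_def solenoid_proj_def cover_carrier)

lemma solenoid_proj_carrier:
  "x \<in> carrier (padic_int_group p) \<Longrightarrow> solenoid_proj p (\<xi>, x) \<in> carrier (solenoid p)"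
  by (auto simp: solenoid_def FactGroup_def RCOSETS_def solenoid_proj_def cover_carrier)

lemma mem_solenoid_proj_iff:
  "v \<in> solenoid_proj p (\<xi>, x) \<longleftrightarrow>
    (\<exists>m. v = (of_int m + \<xi>, padic_of_int p (- m) \<otimes>\<^bsub>padic_int_group p\<^esub> x))"
  by (auto simp: solenoid_proj_def r_coset_def solenoid_lattice_def cover_mult)

lemma solenoid_proj_self:
  assumes "p > 0" "x \<in> carrier (padic_int_group p)"
  shows "(\<xi>, x) \<in> solenoid_proj p (\<xi>, x)"
proof -
  have "padic_of_int p (- 0) \<otimes>\<^bsub>padic_int_group p\<^esub> x = x"
    using padic_carrier_mod[OF assms(2) order_refl]
    by (auto simp: padic_mult padic_of_int_def fun_eq_iff)
  then show ?thesis
    unfolding mem_solenoid_proj_iff by (intro exI[of _ 0]) simp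
qed

lemma mem_solenoid_proj_carrier:
  assumes "p > 0" "x \<in> carrier (padic_int_group p)" "(\<eta>, y) \<in> solenoid_proj p (\<xi>, x)"
  shows "y \<in> carrier (padic_int_group p)"
  using assms by (auto simp: mem_solenoid_proj_iff intro: padic_mult_closed padic_of_int_carrier)

text \<open>
  On representatives the flow of the solenoid only moves the real coordinate.  This turns time
  derivatives along the flow into derivatives with respect to \<open>\<xi>\<close>.
\<close>

lemma solenoid_shift_proj:
  assumes "p > 0" "x \<in> carrier (padic_int_group p)"
  shows "solenoid_shift p t (solenoid_proj p (\<xi>, x)) = solenoid_proj p (\<xi> + t, x)"
proof -
  interpret Z: comm_group "padic_int_group p" by (rule comm_group_padic_int_group[OF assms(1)])
  interpret N: normal "solenoid_lattice p" "solenoid_cover p"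
    by (rule normal_solenoid_lattice[OF assms(1)])
  have "(\<xi>, x) \<in> carrier (solenoid_cover p)" "(t, \<one>\<^bsub>padic_int_group p\<^esub>) \<in> carrier (solenoid_cover p)"
    using assms(2) by (auto simp: cover_carrier)
  from N.rcos_sum[OF this] show ?thesis
    using assms(2) by (simp add: solenoid_shift_def solenoid_def FactGroup_def solenoid_proj_def cover_mult)
qed

section \<open>The characters\<close>

text \<open>
  The digit sum in the definition of \<open>\<chi>\<^sub>n\<close> is the digit expansion of the residue of \<open>x\<close> modulo
  \<open>p\<^sup>n\<^sup>+\<^sup>1\<close>, read from the top digit.
\<close>

lemma padic_digit_expansion:
  assumes "p > 0" "x \<in> carrier (padic_int_group p)"
  shows "(\<Sum>k\<le>n. of_int (padic_digit p x (int n - int k)) / of_nat p ^ k)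
      = (of_int (x (Suc n)) / of_nat p ^ n :: complex)"
proof (induction n)
  case 0
  show ?case by (simp add: padic_digit_def)
next
  case (Suc n)
  have "(\<Sum>k\<le>Suc n. of_int (padic_digit p x (int (Suc n) - int k)) / of_nat p ^ k)
      = of_int (padic_digit p x (int (Suc n)))
        + (\<Sum>k\<le>n. of_int (padic_digit p x (int n - int k)) / of_nat p ^ k) / (of_nat p :: complex)"
    unfolding sum.atMost_Suc_shift by (simp add: sum_divide_distrib mult.commute)
  also have "\<dots> = of_int (padic_digit p x (int (Suc n))) + of_int (x (Suc n)) / of_nat p ^ Suc n"
    by (simp only: Suc.IH) simp
  also have "\<dots> = of_int (padic_digit p x (int (Suc n)) * int p ^ Suc n + x (Suc n)) / of_nat p ^ Suc n"
    using assms(1) by (simp add: field_simps)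
  also have "padic_digit p x (int (Suc n)) * int p ^ Suc n + x (Suc n) = x (Suc (Suc n))"
  proof -
    have "x (Suc n) = x (Suc (Suc n)) mod int p ^ Suc n"
      by (rule padic_carrier_mod[OF assms(2), symmetric]) simp
    then show ?thesis
      unfolding padic_digit_def by (simp add: nat_add_distrib div_mult_mod_eq del: power_Suc)
  qed
  finally show ?case .
qed

text \<open>
  The formula behind all that follows: \<open>\<chi>\<^sub>n\<close> is \<open>exp (2 \<pi> \<i> (\<xi> + x) / p\<^sup>n\<^sup>+\<^sup>1)\<close>, where only the residue
  of \<open>x\<close> matters.  Invariance under \<open>(\<xi>, x) \<mapsto> (\<xi> + m, x - m)\<close>, dependence on finitely many digits
  of \<open>x\<close>, and the derivative in \<open>\<xi>\<close> can all be read off.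
\<close>

lemma chi_cover_nat:
  assumes "p > 0" "x \<in> carrier (padic_int_group p)"
  shows "chi_cover p (int n) (\<xi>, x) = cis (2 * pi * (\<xi> + of_int (x (Suc n))) / real p ^ Suc n)"
proof -
  have "(\<Sum>k. of_int (padic_digit p x (int n - int k)) / of_nat p ^ k)
      = (\<Sum>k\<le>n. of_int (padic_digit p x (int n - int k)) / of_nat p ^ k :: complex)"
    by (rule suminf_finite) (auto simp: padic_digit_def)
  also have "\<dots> = of_int (x (Suc n)) / of_nat p ^ n"
    by (rule padic_digit_expansion[OF assms])
  finally have S: "(\<Sum>k. of_int (padic_digit p x (int n - int k)) / of_nat p ^ k)
      = (of_int (x (Suc n)) / of_nat p ^ n :: complex)" .
  have P: "of_nat p powi (int n + 1) = (of_nat p ^ Suc n :: complex)"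
    using power_int_of_nat[of "of_nat p :: complex" "Suc n"] by (simp add: add.commute)
  show ?thesis
    unfolding chi_cover_def prod.case S P cis_conv_exp exp_add[symmetric]
    using assms(1) by (intro arg_cong[of _ _ exp]) (simp add: field_simps)
qed

lemma chi_cover_minus_one: "chi_cover p (- 1) (\<xi>, x) = cis (2 * pi * \<xi>)"
  by (simp add: chi_cover_def padic_digit_def cis_conv_exp mult.commute mult.left_commute)

lemma cis_add_int_period: "cis (2 * pi * of_int k + \<theta>) = cis \<theta>"
  by (simp flip: cis_mult add: cis_multiple_2pi)

lemma chi_cover_coset:
  assumes "p > 0" "x \<in> carrier (padic_int_group p)" "v \<in> solenoid_proj p (\<xi>, x)"
  shows "chi_cover p (int n) v = chi_cover p (int n) (\<xi>, x)"
    and "chi_cover p (- 1) v = chi_cover p (- 1) (\<xi>, x)"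
proof -
  obtain m where v: "v = (of_int m + \<xi>, padic_of_int p (- m) \<otimes>\<^bsub>padic_int_group p\<^esub> x)"
    using assms(3) by (auto simp: mem_solenoid_proj_iff)
  let ?y = "padic_of_int p (- m) \<otimes>\<^bsub>padic_int_group p\<^esub> x"
  have y: "?y \<in> carrier (padic_int_group p)"
    by (intro padic_mult_closed padic_of_int_carrier assms)
  define q where "q = int p ^ Suc n"
  have "?y (Suc n) = (x (Suc n) - m) mod q"
    by (simp add: padic_mult padic_of_int_def mod_simps q_def)
  then have "(m + ?y (Suc n)) mod q = x (Suc n) mod q"
    by (simp add: mod_simps)
  then obtain k where k: "m + ?y (Suc n) = x (Suc n) + q * k"
    by (metis mod_eq_dvd_iff dvdE add.commute diff_add_cancel)
  have q: "real_of_int q = real p ^ Suc n" "real p ^ Suc n \<noteq> 0"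
    using assms(1) by (simp_all add: q_def)
  have "of_int m + real_of_int (?y (Suc n)) = of_int (x (Suc n)) + real p ^ Suc n * of_int k"
    unfolding q(1)[symmetric] of_int_add[symmetric] of_int_mult[symmetric] k ..
  then have "2 * pi * (of_int m + \<xi> + of_int (?y (Suc n))) / real p ^ Suc n
      = 2 * pi * of_int k + 2 * pi * (\<xi> + of_int (x (Suc n))) / real p ^ Suc n"
    using q(2) by (simp add: divide_eq_eq eq_divide_eq distrib_left distrib_right algebra_simps
        del: power_Suc)
  then show "chi_cover p (int n) v = chi_cover p (int n) (\<xi>, x)"
    unfolding v chi_cover_nat[OF assms(1,2)] chi_cover_nat[OF assms(1) y]
    by (simp only: cis_add_int_period)
  show "chi_cover p (- 1) v = chi_cover p (- 1) (\<xi>, x)"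
    unfolding v chi_cover_minus_one distrib_left by (rule cis_add_int_period)
qed

lemma Omega_cover_eq:
  "Omega_cover p s a u =
    (let z = omega_cover p s u; w = chi_cover p (- 1) u * of_real (cmod a * (1 + Re (z / a)))
     in vector [Re w, cmod a * Im (z / a), Im w])"
proof (cases u)
  case (Pair \<xi> x)
  have "exp (2 * of_real pi * \<i> * of_real \<xi>) = cis (2 * pi * \<xi>)"
    by (simp add: cis_conv_exp mult.commute mult.left_commute)
  then show ?thesis
    by (simp only: Pair Omega_cover_def prod.case chi_cover_minus_one)
qed

lemma chi_and_Omega_proj:
  assumes "p > 0" "x \<in> carrier (padic_int_group p)"
  shows "chi p (- 1) (solenoid_proj p (\<xi>, x)) = chi_cover p (- 1) (\<xi>, x)"
    and "Omega p s a (solenoid_proj p (\<xi>, x)) = Omega_cover p s a (\<xi>, x)"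
proof -
  have ne: "solenoid_proj p (\<xi>, x) \<noteq> {}" using solenoid_proj_self[OF assms, of \<xi>] by blast
  show "chi p (- 1) (solenoid_proj p (\<xi>, x)) = chi_cover p (- 1) (\<xi>, x)"
    unfolding chi_def by (rule the_elem_image_unique[OF ne chi_cover_coset(2)[OF assms]])
  show "Omega p s a (solenoid_proj p (\<xi>, x)) = Omega_cover p s a (\<xi>, x)"
    unfolding Omega_def
    by (rule the_elem_image_unique[OF ne])
      (simp only: Omega_cover_eq omega_cover_def chi_cover_coset[OF assms])
qed

section \<open>Regularity of the series \<open>\<omega>\<close>\<close>

text \<open>
  The exponent \<open>\<alpha> = 1 / D\<^sub>s\<close> is chosen such that \<open>p\<close> to the power \<open>- \<alpha>\<close> is \<open>\<bar>s\<bar>\<close>.  If \<open>x\<close> and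
  \<open>y\<close> differ modulo \<open>p\<^sup>n\<^sup>+\<^sup>1\<close>, then \<open>x - y\<close> has valuation at most \<open>n\<close>.
\<close>

lemma padic_dist_lower_bound:
  assumes "p > 1" "0 < cmod s" "cmod s < 1"
    and x: "x \<in> carrier (padic_int_group p)" and y: "y \<in> carrier (padic_int_group p)"
    and ne: "x (Suc n) \<noteq> y (Suc n)"
  shows "cmod s ^ n \<le> padic_dist p x y powr (1 / fractal_dim p s)"
proof -
  have p: "p > 0" using assms(1) by simp
  define z where "z = x \<otimes>\<^bsub>padic_int_group p\<^esub> inv\<^bsub>padic_int_group p\<^esub> y"
  have zc: "z \<in> carrier (padic_int_group p)"
    unfolding z_def padic_inv[OF p y] by (intro padic_mult_closed padic_neg_closed p x y)
  have "z (Suc n) = (x (Suc n) - y (Suc n)) mod int p ^ Suc n"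
    by (simp add: z_def padic_inv[OF p y] padic_mult mod_simps del: power_Suc)
  moreover have "\<dots> \<noteq> 0"
  proof
    assume "(x (Suc n) - y (Suc n)) mod int p ^ Suc n = 0"
    then have "x (Suc n) mod int p ^ Suc n = y (Suc n) mod int p ^ Suc n"
      using mod_eq_dvd_iff by blast
    then show False using ne by (simp only: padic_carrier_mod[OF x order_refl] padic_carrier_mod[OF y order_refl])
  qed
  ultimately have zn: "z (Suc n) \<noteq> 0" by simp
  then have z0: "z \<noteq> (\<lambda>n. 0)" by auto
  have le: "k \<le> n" if "z k = 0" for k
    using padic_carrier_mod[OF zc, of "Suc n" k] that zn by (cases "k \<le> n") auto
  have "z 0 = 0" using padic_carrier_bounds[OF zc, of 0] by simp
  then have "z (padic_val z) = 0"
    unfolding padic_val_def using le by (intro GreatestI_nat[where P = "\<lambda>n. z n = 0"]) auto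
  then have v: "padic_val z \<le> n" by (rule le)
  have "padic_dist p x y powr (1 / fractal_dim p s)
      = (real p powr log (real p) (cmod s)) powr real (padic_val z)"
    using z0 by (simp add: padic_dist_def flip: z_def)
      (simp add: padic_abs_def powr_powr fractal_dim_def mult.commute)
  also have "\<dots> = cmod s ^ padic_val z"
    using assms by (simp add: powr_realpow)
  finally show ?thesis using v assms by (simp add: power_decreasing)
qed

lemma cmod_cis_diff_le: "cmod (cis x - cis y) \<le> \<bar>x - y\<bar>"
proof -
  have "cis x - cis y = cis y * (exp (\<i> * of_real (x - y)) - 1)"
    unfolding cis_conv_exp[symmetric] by (simp add: right_diff_distrib cis_mult)
  then have "cmod (cis x - cis y) = 2 * \<bar>sin ((x - y) / 2)\<bar>"
    by (simp only: norm_mult norm_cis dist_exp_i_1 mult_1)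
  also have "\<dots> \<le> \<bar>x - y\<bar>"
    using abs_sin_x_le_abs_x[of "(x - y) / 2"] by simp
  finally show ?thesis .
qed

lemma norm_chi_cover: "p > 0 \<Longrightarrow> x \<in> carrier (padic_int_group p) \<Longrightarrow> cmod (chi_cover p (int n) (\<xi>, x)) = 1"
  by (simp only: chi_cover_nat norm_cis)

lemma summable_omega:
  assumes "p > 0" "x \<in> carrier (padic_int_group p)" "cmod s < 1"
  shows "summable (\<lambda>n. s ^ n * chi_cover p (int n) (\<xi>, x))"
  by (rule summable_comparison_test[of _ "\<lambda>n. cmod s ^ n"])
    (use assms in \<open>auto simp: norm_mult norm_power norm_chi_cover intro!: exI[of _ 0] summable_geometric\<close>)

text \<open>
  The bound is the geometric series with ratio \<open>1/2 \<ge> \<bar>s / p\<bar>\<close>.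
\<close>

lemma norm_omega_le:
  assumes "p > 1" "x \<in> carrier (padic_int_group p)" "cmod s < 1"
  shows "cmod (omega_cover p (s / of_nat p) (\<xi>, x)) \<le> 2"
proof -
  have "cmod (s / of_nat p) \<le> 1/2"
    using assms by (auto simp: norm_divide divide_le_eq)
  then have le: "cmod ((s / of_nat p) ^ n * chi_cover p (int n) (\<xi>, x)) \<le> (1/2) ^ n" for n
    using assms by (simp only: norm_mult norm_power norm_chi_cover) (auto intro!: power_mono)
  have "cmod (omega_cover p (s / of_nat p) (\<xi>, x)) \<le> (\<Sum>n. (1/2) ^ n)"
    unfolding omega_cover_def by (intro norm_suminf_le le summable_geometric) auto
  then show ?thesis by (simp add: suminf_geometric)
qed

text \<open>
  The terms with index \<open>n\<close> differ only through \<open>\<xi>\<close> if \<open>x\<close> and \<open>y\<close> agree modulo \<open>p\<^sup>n\<^sup>+\<^sup>1\<close>.  Otherwise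
  the difference of the characters may be as large as 2, but then \<open>\<bar>s\<bar>\<^sup>n\<close> is at most
  \<open>\<bar>x - y\<bar>\<^sub>p\<close> to the power \<open>\<alpha>\<close>.  Either way \<open>\<bar>s\<bar>\<^sup>n\<close> times the difference is bounded by
  the distance, and the remaining factor \<open>p\<^sup>-\<^sup>n\<close>, the gain from passing from \<open>s\<close> to \<open>s / p\<close>,
  makes the series of these bounds converge.
\<close>

lemma omega_cover_lipschitz:
  fixes \<xi> \<eta> :: real
  assumes "p > 1" "0 < cmod s" "cmod s < 1"
    and x: "x \<in> carrier (padic_int_group p)" and y: "y \<in> carrier (padic_int_group p)"
  defines "d \<equiv> max \<bar>\<xi> - \<eta>\<bar> (padic_dist p x y powr (1 / fractal_dim p s))"
  shows "cmod (omega_cover p (s / of_nat p) (\<xi>, x) - omega_cover p (s / of_nat p) (\<eta>, y))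
    \<le> 2 * (2 * pi + 2) * d"
proof -
  have p: "p > 0" using assms(1) by simp
  define T where "T = (\<lambda>n. (s / of_nat p) ^ n * chi_cover p (int n) (\<xi>, x)
      - (s / of_nat p) ^ n * chi_cover p (int n) (\<eta>, y))"
  have sp: "cmod (s / of_nat p) < 1"
    using assms by (auto simp: norm_divide divide_less_eq)
  have d0: "0 \<le> d" by (simp add: d_def le_max_iff_disj)
  have T: "cmod (T n) \<le> (2 * pi + 2) * d * (1/2) ^ n" for n
  proof -
    let ?X = "2 * pi * (\<xi> + of_int (x (Suc n))) / real p ^ Suc n"
    let ?Y = "2 * pi * (\<eta> + of_int (y (Suc n))) / real p ^ Suc n"
    have s1: "cmod s ^ n \<le> 1" using assms by (simp add: power_le_one)
    have "cmod s ^ n * cmod (cis ?X - cis ?Y) \<le> (2 * pi + 2) * d"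
    proof (cases "x (Suc n) = y (Suc n)")
      case True
      have "cmod (cis ?X - cis ?Y) \<le> \<bar>?X - ?Y\<bar>" by (rule cmod_cis_diff_le)
      also have "?X - ?Y = 2 * pi * (\<xi> - \<eta>) / real p ^ Suc n"
        using True p by (simp add: field_simps)
      also have "\<bar>\<dots>\<bar> = 2 * pi * \<bar>\<xi> - \<eta>\<bar> / real p ^ Suc n"
        by (simp add: abs_mult)
      also have "\<dots> \<le> 2 * pi * \<bar>\<xi> - \<eta>\<bar> / 1"
        using assms(1) by (intro divide_left_mono) (auto simp del: power_Suc)
      also have "\<dots> \<le> 2 * pi * d" by (simp add: d_def)
      finally have "cmod (cis ?X - cis ?Y) \<le> 2 * pi * d" .
      then have "cmod s ^ n * cmod (cis ?X - cis ?Y) \<le> 1 * (2 * pi * d)"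
        using s1 by (intro mult_mono) auto
      then show ?thesis using d0 by (simp add: algebra_simps)
    next
      case False
      have "cmod (cis ?X - cis ?Y) \<le> 2"
        using norm_triangle_ineq4[of "cis ?X" "cis ?Y"] by simp
      moreover have "cmod s ^ n \<le> d"
        using padic_dist_lower_bound[OF assms(1-3) x y False] by (simp add: d_def)
      ultimately have "cmod s ^ n * cmod (cis ?X - cis ?Y) \<le> d * 2"
        using d0 by (intro mult_mono) auto
      also have "\<dots> \<le> (2 * pi + 2) * d" using d0 by (simp add: algebra_simps)
      finally show ?thesis .
    qed
    moreover have "inverse (real p) ^ n \<le> (1/2) ^ n"
      using assms(1) by (intro power_mono) (auto simp: field_simps)
    ultimately have le: "(cmod s ^ n * cmod (cis ?X - cis ?Y)) * inverse (real p) ^ n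
        \<le> (2 * pi + 2) * d * (1/2) ^ n"
      by (rule mult_mono) (use d0 in auto)
    have "T n = (s / of_nat p) ^ n * (cis ?X - cis ?Y)"
      by (simp only: T_def chi_cover_nat[OF p x] chi_cover_nat[OF p y] right_diff_distrib)
    moreover have "cmod ((s / of_nat p) ^ n) = cmod s ^ n * inverse (real p) ^ n"
      by (simp add: norm_power norm_divide power_divide field_simps)
    ultimately have "cmod (T n) = (cmod s ^ n * cmod (cis ?X - cis ?Y)) * inverse (real p) ^ n"
      by (simp only: norm_mult mult_ac)
    with le show ?thesis by (simp only:)
  qed
  have "omega_cover p (s / of_nat p) (\<xi>, x) - omega_cover p (s / of_nat p) (\<eta>, y) = suminf T"
    unfolding omega_cover_def T_def by (intro suminf_diff summable_omega p x y sp)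
  moreover have "cmod (suminf T) \<le> (\<Sum>n. (2 * pi + 2) * d * (1/2) ^ n)"
    by (intro norm_suminf_le T summable_mult summable_geometric) auto
  moreover have "\<dots> = 2 * (2 * pi + 2) * d"
    by (subst suminf_mult) (auto intro: summable_geometric simp: suminf_geometric)
  ultimately show ?thesis by simp
qed

text \<open>
  Differentiating \<open>\<chi>\<^sub>n\<close> brings down \<open>2 \<pi> \<i> / p\<^sup>n\<^sup>+\<^sup>1\<close>: the derivative is again a series of the same
  kind, with the parameter \<open>s / p\<close>.
\<close>

lemma omega_cover_derivative:
  assumes "p > 1" "cmod s < 1" and x: "x \<in> carrier (padic_int_group p)"
  shows "((\<lambda>\<xi>. omega_cover p s (\<xi>, x)) has_vector_derivative
      2 * of_real pi * \<i> / of_nat p * omega_cover p (s / of_nat p) (\<xi>, x)) (at \<xi>)"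
proof -
  have p: "p > 0" using assms(1) by simp
  define c :: complex where "c = 2 * of_real pi * \<i> / of_nat p"
  define f where "f = (\<lambda>n \<xi>. s ^ n * chi_cover p (int n) (\<xi>, x))"
  define g where "g = (\<lambda>n \<xi>. (s / of_nat p) ^ n * chi_cover p (int n) (\<xi>, x))"
  define G where "G = (\<lambda>\<xi>. omega_cover p (s / of_nat p) (\<xi>, x))"
  have sp: "cmod (s / of_nat p) \<le> 1/2"
    using assms by (auto simp: norm_divide divide_le_eq)
  have d: "(f n has_derivative (\<lambda>h. of_real h * (c * g n \<xi>))) (at \<xi> within UNIV)" for n \<xi>
  proof -
    have "((\<lambda>\<xi>. 2 * pi * (\<xi> + of_int (x (Suc n))) / real p ^ Suc n) has_derivative
        (\<lambda>h. h * (2 * pi / real p ^ Suc n))) (at \<xi>)"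
      using p by (auto intro!: derivative_eq_intros)
    from has_derivative_mult_right[OF has_derivative_cis[OF this], of "s ^ n"]
    show ?thesis
      unfolding f_def g_def chi_cover_nat[OF p x]
      by (rule has_derivative_eq_rhs)
        (use p in \<open>simp add: c_def scaleR_conv_of_real power_divide fun_eq_iff field_simps\<close>)
  qed
  have unif: "uniform_limit UNIV (\<lambda>n \<xi>. \<Sum>i<n. g i \<xi>) G sequentially"
  proof -
    have "cmod (g n \<xi>) \<le> (1/2) ^ n" for n \<xi>
      using sp by (simp only: g_def norm_mult norm_power norm_chi_cover[OF p x])
        (auto intro!: power_mono)
    then have "uniform_limit UNIV (\<lambda>n \<xi>. \<Sum>i<n. g i \<xi>) (\<lambda>\<xi>. \<Sum>n. g n \<xi>) sequentially"
      by (intro Weierstrass_m_test[where M = "\<lambda>n. (1/2) ^ n"]) auto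
    then show ?thesis by (simp only: G_def omega_cover_def g_def)
  qed
  have c: "cmod c > 0" using p by (simp add: c_def norm_mult norm_divide)
  have "\<exists>F. \<forall>\<xi>\<in>UNIV. (\<lambda>n. f n \<xi>) sums F \<xi> \<and>
      (F has_derivative (\<lambda>h. of_real h * (c * G \<xi>))) (at \<xi> within UNIV)"
  proof (rule has_derivative_series[OF convex_UNIV d _ UNIV_I])
    show "\<forall>\<^sub>F n in sequentially. \<forall>\<xi>\<in>UNIV. \<forall>h.
        norm ((\<Sum>i<n. of_real h * (c * g i \<xi>)) - of_real h * (c * G \<xi>)) \<le> e * norm h"
      if "e > 0" for e
    proof -
      have "\<forall>\<^sub>F n in sequentially. \<forall>\<xi>\<in>UNIV. dist (\<Sum>i<n. g i \<xi>) (G \<xi>) < e / cmod c"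
        using uniform_limitD[OF unif] that c by simp
      then show ?thesis
      proof (rule eventually_mono, intro ballI allI)
        fix n \<xi> h assume "\<forall>\<xi>\<in>UNIV. dist (\<Sum>i<n. g i \<xi>) (G \<xi>) < e / cmod c"
        then have "cmod ((\<Sum>i<n. g i \<xi>) - G \<xi>) * cmod c \<le> e"
          using c by (auto simp: dist_norm field_simps intro: less_imp_le)
        then have "\<bar>h\<bar> * (cmod ((\<Sum>i<n. g i \<xi>) - G \<xi>) * cmod c) \<le> \<bar>h\<bar> * e"
          by (intro mult_left_mono) auto
        moreover have "(\<Sum>i<n. of_real h * (c * g i \<xi>)) - of_real h * (c * G \<xi>)
            = of_real h * (((\<Sum>i<n. g i \<xi>) - G \<xi>) * c)"
          by (simp add: sum_distrib_left algebra_simps)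
        ultimately show "norm ((\<Sum>i<n. of_real h * (c * g i \<xi>)) - of_real h * (c * G \<xi>)) \<le> e * norm h"
          by (simp only: norm_mult norm_of_real) (simp add: mult.commute)
      qed
    qed
    show "(\<lambda>n. f n 0) sums omega_cover p s (0, x)"
      unfolding f_def omega_cover_def by (intro summable_sums summable_omega p x assms(2))
  qed
  then obtain F where F: "\<And>\<xi>. (\<lambda>n. f n \<xi>) sums F \<xi>"
      "\<And>\<xi>. (F has_derivative (\<lambda>h. of_real h * (c * G \<xi>))) (at \<xi>)" by auto
  have "F = (\<lambda>\<xi>. omega_cover p s (\<xi>, x))"
    using F(1) by (auto simp: f_def omega_cover_def sums_iff)
  with F(2)[of \<xi>] show ?thesis
    by (simp add: has_vector_derivative_def c_def G_def scaleR_conv_of_real)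
qed

section \<open>The vector field on the image of the solenoid\<close>

lemma vector3_eq:
  "(vector [a, b, c] :: real ^ 3) = a *\<^sub>R axis 1 1 + b *\<^sub>R axis 2 1 + c *\<^sub>R axis 3 1"
  by (simp add: vec_eq_iff forall_3 axis_def)

lemma vector3_has_vector_derivative:
  assumes "(f has_real_derivative f') (at t)" "(g has_real_derivative g') (at t)"
    "(h has_real_derivative h') (at t)"
  shows "((\<lambda>t. vector [f t, g t, h t] :: real ^ 3) has_vector_derivative vector [f', g', h']) (at t)"
  unfolding vector3_eq
  by (intro has_vector_derivative_add
      bounded_linear.has_vector_derivative[OF bounded_linear_scaleR_left]
      assms[unfolded has_real_derivative_iff_has_vector_derivative])

lemma vector3_tendsto:
  assumes "(f \<longlongrightarrow> f') F" "(g \<longlongrightarrow> g') F" "(h \<longlongrightarrow> h') F"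
  shows "((\<lambda>t. vector [f t, g t, h t] :: real ^ 3) \<longlongrightarrow> vector [f', g', h']) F"
  unfolding vector3_eq by (intro tendsto_intros assms)

lemma rot_gen_2_mult: "rot_gen 2 *v (vector [x, y, z] :: real ^ 3) = vector [- z, 0, x]"
  by (simp add: vec_eq_iff forall_3 matrix_vector_mult_def sum_3 rot_gen_def levi_civita_def)

text \<open>
  The matrix is \<open>Re E * L\<^sub>3 - Im E * L\<^sub>1\<close>.
\<close>

lemma Re_rotated_gen_mult:
  "map_matrix Re (mat E ** (rot_gen 3 + mat \<i> ** rot_gen 1)) *v (vector [x, y, z] :: real ^ 3)
    = vector [Re E * y, - Re E * x - Im E * z, Im E * y]"
  by (simp add: vec_eq_iff forall_3 matrix_vector_mult_def matrix_matrix_mult_def map_matrix_def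
      mat_def sum_3 rot_gen_def levi_civita_def)

text \<open>
  The part of the velocity that is not the rotation about the second axis, up to the factor
  \<open>- 2 \<pi> / p\<close>.  It is what the matrix expression in the vector field amounts to, and it is written
  through quantities on the covering group that are constant on the cosets.
\<close>

definition drift :: "nat \<Rightarrow> complex \<Rightarrow> complex \<Rightarrow> real \<times> (nat \<Rightarrow> int) \<Rightarrow> real ^ 3" where
  "drift p s a u =
    (let q = omega_cover p (s / of_nat p) u / a; E = chi_cover p (- 1) u
     in vector [cmod a * (Re E * Im q), - (cmod a * Re q), cmod a * (Im E * Im q)])"

lemma drift_coset:
  assumes "p > 0" "x \<in> carrier (padic_int_group p)" "v \<in> solenoid_proj p (\<xi>, x)"
  shows "drift p s a v = drift p s a (\<xi>, x)"
  by (simp only: drift_def omega_cover_def chi_cover_coset[OF assms])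

text \<open>
  In \<open>\<bar>\<epsilon> a\<bar> (1 + Re (z / (\<epsilon> a)))\<close> the factors \<open>\<epsilon> > 0\<close> cancel except at the summand 1, which
  disappears in the limit.
\<close>

lemma Omega_plus0_proj:
  assumes "p > 0" "x \<in> carrier (padic_int_group p)"
  shows "Omega_plus0 p s a (solenoid_proj p (\<xi>, x)) =
    (let q = omega_cover p s (\<xi>, x) / a; w = chi_cover p (- 1) (\<xi>, x) * of_real (cmod a * Re q)
     in vector [Re w, cmod a * Im q, Im w])"
proof -
  define E where "E = chi_cover p (- 1) (\<xi>, x)"
  define q where "q = omega_cover p s (\<xi>, x) / a"
  have "((\<lambda>\<epsilon>. vector [Re (E * of_real (\<epsilon> * cmod a + cmod a * Re q)), cmod a * Im q,
      Im (E * of_real (\<epsilon> * cmod a + cmod a * Re q))] :: real ^ 3) \<longlongrightarrow>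
      vector [Re (E * of_real (0 * cmod a + cmod a * Re q)), cmod a * Im q,
        Im (E * of_real (0 * cmod a + cmod a * Re q))]) (at_right 0)"
    by (intro vector3_tendsto tendsto_intros)
  moreover have "\<forall>\<^sub>F \<epsilon> in at_right 0. vector [Re (E * of_real (\<epsilon> * cmod a + cmod a * Re q)),
        cmod a * Im q, Im (E * of_real (\<epsilon> * cmod a + cmod a * Re q))]
      = Omega p s (of_real \<epsilon> * a) (solenoid_proj p (\<xi>, x))"
    using eventually_at_right_less[of 0]
  proof eventually_elim
    case (elim \<epsilon>)
    have z: "omega_cover p s (\<xi>, x) / (of_real \<epsilon> * a) = q / of_real \<epsilon>"
      by (simp add: q_def)
    have m: "cmod (of_real \<epsilon> * a) * (1 + Re (q / of_real \<epsilon>)) = \<epsilon> * cmod a + cmod a * Re q"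
      "cmod (of_real \<epsilon> * a) * Im (q / of_real \<epsilon>) = cmod a * Im q"
      using elim by (simp_all add: norm_mult field_simps)
    show ?case
      unfolding chi_and_Omega_proj[OF assms] Omega_cover_eq Let_def z m E_def[symmetric] ..
  qed
  ultimately have "((\<lambda>\<epsilon>. Omega p s (of_real \<epsilon> * a) (solenoid_proj p (\<xi>, x))) \<longlongrightarrow>
      vector [Re (E * of_real (0 * cmod a + cmod a * Re q)), cmod a * Im q,
        Im (E * of_real (0 * cmod a + cmod a * Re q))]) (at_right 0)"
    by (rule Lim_transform_eventually)
  from tendsto_Lim[OF trivial_limit_at_right_real this]
  show ?thesis by (simp add: Omega_plus0_def Let_def E_def q_def)
qed

text \<open>
  The prescribed vector field in a form that is comparable with the derivative of \<^const>\<open>Omega_cover\<close>.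
  The two components of \<^const>\<open>Omega_plus0\<close> outside the second axis combine, since
  \<open>cos\<^sup>2 + sin\<^sup>2 = 1\<close>.
\<close>

lemma solenoid_field_eq:
  fixes \<xi> :: real
  assumes "p > 0" "x \<in> carrier (padic_int_group p)"
  defines "f \<equiv> solenoid_proj p (\<xi>, x)"
  shows "(- 2 * pi) *\<^sub>R
      (- (rot_gen 2 *v Omega p s a f) +
       inverse (real p) *\<^sub>R
         (map_matrix Re (mat (chi p (- 1) f) ** (rot_gen 3 + mat \<i> ** rot_gen 1)) *v
          Omega_plus0 p (s / of_nat p) a f))
    = (2 * pi) *\<^sub>R (rot_gen 2 *v Omega p s a f) - (2 * pi / real p) *\<^sub>R drift p s a (\<xi>, x)"
proof -
  define E where "E = chi_cover p (- 1) (\<xi>, x)"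
  define q where "q = omega_cover p (s / of_nat p) (\<xi>, x) / a"
  have EE: "(Re E)\<^sup>2 + (Im E)\<^sup>2 = 1"
    by (simp add: E_def chi_cover_minus_one)
  have "- Re E * Re (E * of_real (cmod a * Re q)) - Im E * Im (E * of_real (cmod a * Re q))
      = - (((Re E)\<^sup>2 + (Im E)\<^sup>2) * (cmod a * Re q))"
    by (simp add: power2_eq_square algebra_simps)
  also have "\<dots> = - (cmod a * Re q)" by (simp only: EE mult_1)
  finally have "map_matrix Re (mat E ** (rot_gen 3 + mat \<i> ** rot_gen 1)) *v
      Omega_plus0 p (s / of_nat p) a f = drift p s a (\<xi>, x)"
    unfolding f_def Omega_plus0_proj[OF assms(1,2)] drift_def Let_def E_def[symmetric]
      q_def[symmetric] Re_rotated_gen_mult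
    by (simp add: mult.left_commute)
  then show ?thesis
    unfolding f_def chi_and_Omega_proj(1)[OF assms(1,2)] E_def
    by (simp add: algebra_simps divide_inverse)
qed

text \<open>
  The curves \<open>t \<mapsto> \<Omega>(f\<^sub>t)\<close> have the prescribed velocity: the factor \<open>exp (2 \<pi> \<i> \<xi>)\<close> contributes the
  rotation, and the derivative of \<open>\<omega>\<close> contributes the drift.
\<close>

lemma Omega_cover_derivative:
  assumes "p > 1" "cmod s < 1" "x \<in> carrier (padic_int_group p)"
  shows "((\<lambda>\<xi>. Omega_cover p s a (\<xi>, x)) has_vector_derivative
      (2 * pi) *\<^sub>R (rot_gen 2 *v Omega_cover p s a (\<xi>, x)) - (2 * pi / real p) *\<^sub>R drift p s a (\<xi>, x))
    (at \<xi>)"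
proof -
  define q where "q = omega_cover p (s / of_nat p) (\<xi>, x) / a"
  \<comment> \<open>\<open>A\<close> and \<open>B\<close> are the coordinates of the point in the plane that the factor \<open>exp (2 \<pi> \<i> \<xi>)\<close> rotates.\<close>
  define A where "A = (\<lambda>\<xi>. cmod a * (1 + Re (omega_cover p s (\<xi>, x) / a)))"
  define B where "B = (\<lambda>\<xi>. cmod a * Im (omega_cover p s (\<xi>, x) / a))"
  have d: "((\<lambda>\<xi>. omega_cover p s (\<xi>, x) / a) has_vector_derivative
      2 * of_real pi * \<i> / of_nat p * q) (at \<xi>)"
    using bounded_linear.has_vector_derivative[OF bounded_linear_divide omega_cover_derivative[OF assms]]
    by (simp add: q_def)
  have dRe: "((\<lambda>\<xi>. Re (omega_cover p s (\<xi>, x) / a)) has_real_derivative - (2 * pi / real p * Im q)) (at \<xi>)"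
    using bounded_linear.has_vector_derivative[OF bounded_linear_Re d]
    by (simp add: has_real_derivative_iff_has_vector_derivative)
  have dIm: "((\<lambda>\<xi>. Im (omega_cover p s (\<xi>, x) / a)) has_real_derivative 2 * pi / real p * Re q) (at \<xi>)"
    using bounded_linear.has_vector_derivative[OF bounded_linear_Im d]
    by (simp add: has_real_derivative_iff_has_vector_derivative)
  have dA: "(A has_real_derivative - (2 * pi / real p * (cmod a * Im q))) (at \<xi>)"
    unfolding A_def by (rule DERIV_cong[OF DERIV_cmult[OF DERIV_add[OF DERIV_const dRe]]]) simp
  have dB: "(B has_real_derivative 2 * pi / real p * (cmod a * Re q)) (at \<xi>)"
    unfolding B_def by (rule DERIV_cong[OF DERIV_cmult[OF dIm]]) simp
  have eq: "Omega_cover p s a (\<xi>, x) = vector [cos (2 * pi * \<xi>) * A \<xi>, B \<xi>, sin (2 * pi * \<xi>) * A \<xi>]"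
    for \<xi> by (simp add: Omega_cover_eq chi_cover_minus_one A_def B_def Let_def)
  have "((\<lambda>\<xi>. vector [cos (2 * pi * \<xi>) * A \<xi>, B \<xi>, sin (2 * pi * \<xi>) * A \<xi>] :: real ^ 3)
      has_vector_derivative vector
        [- (2 * pi * sin (2 * pi * \<xi>)) * A \<xi> + cos (2 * pi * \<xi>) * - (2 * pi / real p * (cmod a * Im q)),
         2 * pi / real p * (cmod a * Re q),
         2 * pi * cos (2 * pi * \<xi>) * A \<xi> + sin (2 * pi * \<xi>) * - (2 * pi / real p * (cmod a * Im q))]) (at \<xi>)"
    by (rule vector3_has_vector_derivative[OF _ dB]) (auto intro!: derivative_eq_intros dA)
  also have "vector
        [- (2 * pi * sin (2 * pi * \<xi>)) * A \<xi> + cos (2 * pi * \<xi>) * - (2 * pi / real p * (cmod a * Im q)),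
         2 * pi / real p * (cmod a * Re q),
         2 * pi * cos (2 * pi * \<xi>) * A \<xi> + sin (2 * pi * \<xi>) * - (2 * pi / real p * (cmod a * Im q))]
      = (2 * pi) *\<^sub>R (rot_gen 2 *v Omega_cover p s a (\<xi>, x)) - (2 * pi / real p) *\<^sub>R drift p s a (\<xi>, x)"
    by (simp add: eq rot_gen_2_mult drift_def Let_def chi_cover_minus_one vec_eq_iff forall_3
        flip: q_def)
  finally show ?thesis by (simp only: eq)
qed

text \<open>
  Each component is a product of a component of \<open>exp (2 \<pi> \<i> \<xi>)\<close> and one of the bounded function
  \<open>\<omega>\<close> for the parameter \<open>s / p\<close>.  The factor \<open>\<bar>a\<bar>\<close> cancels the division by \<open>a\<close>, so the constant is
  absolute.
\<close>

lemma drift_lipschitz_on_cover: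
  fixes \<xi> \<eta> :: real
  assumes "p > 1" "0 < cmod s" "cmod s < 1" "a \<noteq> 0"
    and x: "x \<in> carrier (padic_int_group p)" and y: "y \<in> carrier (padic_int_group p)"
  defines "d \<equiv> max \<bar>\<xi> - \<eta>\<bar> (padic_dist p x y powr (1 / fractal_dim p s))"
  shows "norm (drift p s a (\<xi>, x) - drift p s a (\<eta>, y)) \<le> 3 * (8 * pi + 4) * d"
proof -
  define z where "z = omega_cover p (s / of_nat p) (\<xi>, x)"
  define z' where "z' = omega_cover p (s / of_nat p) (\<eta>, y)"
  define E where "E = cis (2 * pi * \<xi>)"
  define E' where "E' = cis (2 * pi * \<eta>)"
  define q where "q = cmod a * z / a"
  define q' where "q' = cmod a * z' / a"
  have d0: "0 \<le> d" by (simp add: d_def le_max_iff_disj)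
  have q: "cmod q \<le> 2"
    using norm_omega_le[OF assms(1) x assms(3)] assms(4) by (simp add: q_def z_def norm_mult norm_divide)
  have "cmod (q - q') = cmod (z - z')"
    using assms(4) by (simp add: q_def q'_def norm_mult norm_divide flip: right_diff_distrib diff_divide_distrib)
  also have "\<dots> \<le> 2 * (2 * pi + 2) * d"
    unfolding z_def z'_def d_def by (rule omega_cover_lipschitz[OF assms(1-3) x y])
  finally have qq: "cmod (q - q') \<le> 2 * (2 * pi + 2) * d" .
  have "cmod (E - E') \<le> \<bar>2 * pi * \<xi> - 2 * pi * \<eta>\<bar>"
    unfolding E_def E'_def by (rule cmod_cis_diff_le)
  also have "\<dots> = 2 * pi * \<bar>\<xi> - \<eta>\<bar>" by (simp add: abs_mult flip: right_diff_distrib)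
  also have "\<dots> \<le> 2 * pi * d" by (simp add: d_def)
  finally have EE: "cmod (E - E') \<le> 2 * pi * d" .
  have prod: "\<bar>e * Im q - e' * Im q'\<bar> \<le> (8 * pi + 4) * d"
    if "\<bar>e - e'\<bar> \<le> cmod (E - E')" "\<bar>e'\<bar> \<le> 1" for e e'
  proof -
    have "e * Im q - e' * Im q' = (e - e') * Im q + e' * Im (q - q')"
      by (simp add: algebra_simps)
    then have "\<bar>e * Im q - e' * Im q'\<bar> \<le> \<bar>e - e'\<bar> * \<bar>Im q\<bar> + \<bar>e'\<bar> * \<bar>Im (q - q')\<bar>"
      by (metis abs_mult abs_triangle_ineq)
    also have "\<bar>e - e'\<bar> * \<bar>Im q\<bar> \<le> (2 * pi * d) * 2"
      by (rule mult_mono) (use that EE q d0 abs_Im_le_cmod[of q] in auto)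
    also have "\<bar>e'\<bar> * \<bar>Im (q - q')\<bar> \<le> 1 * (2 * (2 * pi + 2) * d)"
      by (rule mult_mono) (use that(2) qq d0 abs_Im_le_cmod[of "q - q'"] in auto)
    finally show ?thesis by (simp add: algebra_simps)
  qed
  have "\<bar>Re E - Re E'\<bar> \<le> cmod (E - E')" "\<bar>Im E - Im E'\<bar> \<le> cmod (E - E')"
    using abs_Re_le_cmod[of "E - E'"] abs_Im_le_cmod[of "E - E'"] by auto
  moreover have "\<bar>Re E'\<bar> \<le> 1" "\<bar>Im E'\<bar> \<le> 1"
    by (auto simp: E'_def)
  ultimately have c13: "\<bar>Re E * Im q - Re E' * Im q'\<bar> \<le> (8 * pi + 4) * d"
      "\<bar>Im E * Im q - Im E' * Im q'\<bar> \<le> (8 * pi + 4) * d"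
    by (intro prod; simp)+
  have "\<bar>Re q' - Re q\<bar> \<le> cmod (q - q')"
    using abs_Re_le_cmod[of "q - q'"] by simp
  also have "\<dots> \<le> (8 * pi + 4) * d"
    using qq mult_nonneg_nonneg[OF pi_ge_zero d0] by (simp add: algebra_simps)
  finally have c2: "\<bar>Re q' - Re q\<bar> \<le> (8 * pi + 4) * d" .
  have "drift p s a (\<xi>, x) - drift p s a (\<eta>, y)
      = vector [Re E * Im q - Re E' * Im q', Re q' - Re q, Im E * Im q - Im E' * Im q']"
    unfolding drift_def Let_def chi_cover_minus_one z_def[symmetric] z'_def[symmetric]
      E_def[symmetric] E'_def[symmetric]
    by (simp add: vec_eq_iff forall_3 q_def q'_def Re_divide Im_divide algebra_simps)
  then have "norm (drift p s a (\<xi>, x) - drift p s a (\<eta>, y))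
      \<le> \<bar>Re E * Im q - Re E' * Im q'\<bar> + \<bar>Re q' - Re q\<bar> + \<bar>Im E * Im q - Im E' * Im q'\<bar>"
    using norm_le_l1_cart[of "drift p s a (\<xi>, x) - drift p s a (\<eta>, y)"] by (simp add: sum_3)
  then show ?thesis using c13 c2 by (simp add: algebra_simps)
qed

lemma solenoid_dist_greatest:
  assumes "f \<noteq> {}" "g \<noteq> {}" "C > 0"
    and "\<And>\<xi> x \<eta> y. (\<xi>, x) \<in> f \<Longrightarrow> (\<eta>, y) \<in> g \<Longrightarrow>
      D \<le> C * max \<bar>\<xi> - \<eta>\<bar> (padic_dist p x y powr \<alpha>)"
  shows "D \<le> C * solenoid_dist p \<alpha> f g"
proof -
  have "D / C \<le> solenoid_dist p \<alpha> f g"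
    unfolding solenoid_dist_def
  proof (rule cInf_greatest)
    show "{max \<bar>\<xi> - \<eta>\<bar> (padic_dist p x y powr \<alpha>) | \<xi> x \<eta> y. (\<xi>, x) \<in> f \<and> (\<eta>, y) \<in> g} \<noteq> {}"
      using assms(1,2) by auto
  qed (use assms(3,4) in \<open>auto simp: divide_le_eq mult.commute\<close>)
  then show ?thesis using assms(3) by (simp add: divide_le_eq mult.commute)
qed

text \<open>
  The metric of the solenoid is an infimum over representatives.  The estimate on the covering group
  has the same left-hand side for all representatives, so it passes to the infimum.
\<close>

lemma drift_lipschitz:
  assumes "p > 1" "0 < cmod s" "cmod s < 1" "a \<noteq> 0"
    and x: "x \<in> carrier (padic_int_group p)" and y: "y \<in> carrier (padic_int_group p)"
  shows "norm (drift p s a (\<xi>, x) - drift p s a (\<eta>, y))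
    \<le> 3 * (8 * pi + 4) * solenoid_dist p (1 / fractal_dim p s) (solenoid_proj p (\<xi>, x)) (solenoid_proj p (\<eta>, y))"
proof (rule solenoid_dist_greatest)
  have p: "p > 0" using assms(1) by simp
  show "solenoid_proj p (\<xi>, x) \<noteq> {}" "solenoid_proj p (\<eta>, y) \<noteq> {}"
    using solenoid_proj_self[OF p x] solenoid_proj_self[OF p y] by blast+
  show "0 < 3 * (8 * pi + 4)" by (simp add: add_pos_pos)
  fix \<xi>' x' \<eta>' y'
  assume x': "(\<xi>', x') \<in> solenoid_proj p (\<xi>, x)" and y': "(\<eta>', y') \<in> solenoid_proj p (\<eta>, y)"
  show "norm (drift p s a (\<xi>, x) - drift p s a (\<eta>, y))
      \<le> 3 * (8 * pi + 4) * max \<bar>\<xi>' - \<eta>'\<bar> (padic_dist p x' y' powr (1 / fractal_dim p s))"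
    unfolding drift_coset[OF p x x', symmetric] drift_coset[OF p y y', symmetric]
    by (rule drift_lipschitz_on_cover[OF assms(1-4) mem_solenoid_proj_carrier[OF p x x']
          mem_solenoid_proj_carrier[OF p y y']])
qed

section \<open>The globally defined vector field and its flow\<close>

text \<open>
  The inequality says both that \<open>F\<close> is a function of \<open>\<Phi>\<close> (take \<open>\<Phi> f = \<Phi> g\<close>) and that this function is
  Lipschitz on the image of \<open>\<Phi>\<close>, so that it extends.
\<close>

lemma factors_through_lipschitz_map:
  fixes \<Phi> :: "'a \<Rightarrow> 'b::metric_space" and F :: "'a \<Rightarrow> 'c::euclidean_space"
  assumes "M \<ge> 0" and le: "\<And>f g. f \<in> A \<Longrightarrow> g \<in> A \<Longrightarrow> dist (F f) (F g) \<le> M * dist (\<Phi> f) (\<Phi> g)"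
  obtains L \<Gamma> where "L-lipschitz_on UNIV \<Gamma>" "\<And>f. f \<in> A \<Longrightarrow> \<Gamma> (\<Phi> f) = F f"
proof -
  define h where "h = (\<lambda>r. F (inv_into A \<Phi> r))"
  have h: "h (\<Phi> f) = F f" if "f \<in> A" for f
  proof -
    have "inv_into A \<Phi> (\<Phi> f) \<in> A" "\<Phi> (inv_into A \<Phi> (\<Phi> f)) = \<Phi> f"
      using that by (auto intro: inv_into_into f_inv_into_f)
    with le[OF this(1) that] show ?thesis by (simp add: h_def)
  qed
  have "M-lipschitz_on (\<Phi> ` A) h"
    by (rule lipschitz_onI) (use h le assms(1) in auto)
  then obtain L \<Gamma> where "L-lipschitz_on UNIV \<Gamma>" "\<And>r. r \<in> \<Phi> ` A \<Longrightarrow> \<Gamma> r = h r"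
    using euclidean_lipschitz_extension[of M "\<Phi> ` A" h] by blast
  with that h show ?thesis by auto
qed

theorem theorem9:
  fixes p :: nat and s a :: complex
  assumes "prime p"
    and "0 < cmod s" "cmod s < 1"
    and "a \<noteq> 0"
    and "L_isometry_on (carrier (solenoid p)) (solenoid_dist p (1 / fractal_dim p s)) dist
           (Omega p s a)"
  shows "\<exists>\<Gamma> :: real ^ 3 \<Rightarrow> real ^ 3.
    (\<exists>C. C-lipschitz_on UNIV \<Gamma>) \<and>
    (\<forall>f\<in>carrier (solenoid p).
      \<Gamma> (Omega p s a f) =
        (- 2 * pi) *\<^sub>R
          (- (rot_gen 2 *v Omega p s a f) +
           inverse (real p) *\<^sub>R
             (map_matrix Re (mat (chi p (- 1) f) ** (rot_gen 3 + mat \<i> ** rot_gen 1)) *v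
              Omega_plus0 p (s / of_nat p) a f))) \<and>
    (\<exists>!U. homeo_group_generated_by \<Gamma> U) \<and>
    (\<forall>U. homeo_group_generated_by \<Gamma> U \<longrightarrow>
      (\<forall>f\<in>carrier (solenoid p). \<forall>t. Omega p s a (solenoid_shift p t f) = U t (Omega p s a f)))"
proof -
  have p1: "p > 1" using assms(1) by (rule prime_gt_1_nat)
  then have p: "p > 0" by simp
  define F where "F = (\<lambda>f. (- 2 * pi) *\<^sub>R
          (- (rot_gen 2 *v Omega p s a f) +
           inverse (real p) *\<^sub>R
             (map_matrix Re (mat (chi p (- 1) f) ** (rot_gen 3 + mat \<i> ** rot_gen 1)) *v
              Omega_plus0 p (s / of_nat p) a f)))"
  have F: "F (solenoid_proj p (\<xi>, x)) =
      (2 * pi) *\<^sub>R (rot_gen 2 *v Omega p s a (solenoid_proj p (\<xi>, x)))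
      - (2 * pi / real p) *\<^sub>R drift p s a (\<xi>, x)"
    if "x \<in> carrier (padic_int_group p)" for \<xi> x
    unfolding F_def by (rule solenoid_field_eq[OF p that])
  obtain C where C: "C \<ge> 1"
    and iso: "\<And>f g. f \<in> carrier (solenoid p) \<Longrightarrow> g \<in> carrier (solenoid p) \<Longrightarrow>
      inverse C * solenoid_dist p (1 / fractal_dim p s) f g \<le> dist (Omega p s a f) (Omega p s a g)"
    using assms(5) unfolding L_isometry_on_def by blast
  obtain K where K: "K \<ge> 0" "\<And>r :: real ^ 3. norm (rot_gen 2 *v r) \<le> norm r * K"
    using bounded_linear.nonneg_bounded[OF matrix_vector_mul_bounded_linear] by metis
  \<comment> \<open>The lower bound of the L-isometry is what makes the field Lipschitz for the Euclidean distance: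
    the drift is Lipschitz for the metric of the solenoid, which is at most \<open>C\<close> times the distance
    of the images.\<close>
  define D where "D = 3 * (8 * pi + 4)"
  have D: "D \<ge> 0" by (simp add: D_def)
  have lip: "dist (F f) (F g) \<le> (2 * pi * K + 2 * pi / real p * (D * C)) * dist (Omega p s a f) (Omega p s a g)"
    if fg: "f \<in> carrier (solenoid p)" "g \<in> carrier (solenoid p)" for f g
  proof -
    let ?d = "dist (Omega p s a f) (Omega p s a g)"
    obtain \<xi> x \<eta> y where x: "x \<in> carrier (padic_int_group p)" "f = solenoid_proj p (\<xi>, x)"
      and y: "y \<in> carrier (padic_int_group p)" "g = solenoid_proj p (\<eta>, y)"
      using fg by (metis solenoid_carrierE)
    have "norm (drift p s a (\<xi>, x) - drift p s a (\<eta>, y))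
        \<le> D * solenoid_dist p (1 / fractal_dim p s) f g"
      unfolding x(2) y(2) D_def by (rule drift_lipschitz[OF p1 assms(2-4) x(1) y(1)])
    also have "\<dots> \<le> D * (C * ?d)"
      using iso[OF fg] C D by (intro mult_left_mono) (auto simp: field_simps)
    finally have drift: "norm (drift p s a (\<xi>, x) - drift p s a (\<eta>, y)) \<le> D * (C * ?d)" .
    have "F f - F g = (2 * pi) *\<^sub>R (rot_gen 2 *v (Omega p s a f - Omega p s a g))
        - (2 * pi / real p) *\<^sub>R (drift p s a (\<xi>, x) - drift p s a (\<eta>, y))"
      unfolding x(2) y(2) F[OF x(1)] F[OF y(1)]
      by (simp add: matrix_vector_mult_diff_distrib scaleR_diff_right)
    also have "norm \<dots> \<le> norm ((2 * pi) *\<^sub>R (rot_gen 2 *v (Omega p s a f - Omega p s a g)))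
        + norm ((2 * pi / real p) *\<^sub>R (drift p s a (\<xi>, x) - drift p s a (\<eta>, y)))"
      by (rule norm_triangle_ineq4)
    also have "\<dots> = 2 * pi * norm (rot_gen 2 *v (Omega p s a f - Omega p s a g))
        + 2 * pi / real p * norm (drift p s a (\<xi>, x) - drift p s a (\<eta>, y))"
      by simp
    also have "\<dots> \<le> 2 * pi * (?d * K) + 2 * pi / real p * (D * (C * ?d))"
      using K(2)[of "Omega p s a f - Omega p s a g"] drift
      by (intro add_mono mult_left_mono) (auto simp: dist_norm)
    finally show ?thesis by (simp add: dist_norm algebra_simps)
  qed
  have "0 \<le> 2 * pi * K + 2 * pi / real p * (D * C)" using K(1) D C by simp
  from factors_through_lipschitz_map[of _ "carrier (solenoid p)" F "Omega p s a", OF this lip]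
  obtain L \<Gamma> where \<Gamma>: "L-lipschitz_on UNIV \<Gamma>"
      "\<And>f. f \<in> carrier (solenoid p) \<Longrightarrow> \<Gamma> (Omega p s a f) = F f" by blast
  have "Omega p s a (solenoid_shift p t f) = U t (Omega p s a f)"
    if U: "homeo_group_generated_by \<Gamma> U" and f: "f \<in> carrier (solenoid p)" for U f t
  proof -
    obtain \<xi> x where x: "x \<in> carrier (padic_int_group p)" "f = solenoid_proj p (\<xi>, x)"
      using f by (rule solenoid_carrierE)
    define r where "r = (\<lambda>t. Omega_cover p s a (\<xi> + t, x))"
    have r: "r t = Omega p s a (solenoid_shift p t f)" for t
      by (simp add: r_def x(2) solenoid_shift_proj p x(1) chi_and_Omega_proj)
    have "(r has_vector_derivative \<Gamma> (r t)) (at t)" for t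
    proof -
      have "((+) \<xi> has_vector_derivative 1) (at t)"
        by (auto intro!: derivative_eq_intros)
      from vector_diff_chain_at[OF this Omega_cover_derivative[OF p1 assms(3) x(1)]]
      have "(r has_vector_derivative F (solenoid_proj p (\<xi> + t, x))) (at t)"
        by (simp add: r_def o_def F[OF x(1)] chi_and_Omega_proj[OF p x(1)])
      also have "F (solenoid_proj p (\<xi> + t, x)) = \<Gamma> (r t)"
        using \<Gamma>(2)[OF solenoid_proj_carrier[OF x(1)]]
        by (simp add: r_def chi_and_Omega_proj[OF p x(1)])
      finally show ?thesis .
    qed
    moreover have "r 0 = Omega p s a f"
      by (simp add: r_def x(2) chi_and_Omega_proj[OF p x(1)])
    ultimately have "r = (\<lambda>t. U t (Omega p s a f))"
      using U by (intro lipschitz_ode_solution_unique[OF \<Gamma>(1)])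
        (auto simp: homeo_group_generated_by_def)
    then show ?thesis by (metis r)
  qed
  with \<Gamma> lipschitz_field_generates_flow[OF \<Gamma>(1)] show ?thesis
    unfolding F_def by blast
qed

end
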